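(* Let $\Gamma$ be a simple graph on $V=\{1,\dots,n\}$ with edge ideal $I\subseteq k[x_1,\dots,x_n]$. Then $\operatorname{astab}(I)\le s(\Gamma)$.
   Context: $k$ is a field, $n\ge 1$. The edge ideal of $\Gamma$ is the ideal generated by the $x_ix_j$ with $\{i,j\}$ an edge of $\Gamma$. $\operatorname{Ass}(I^t)$ is the set of associated primes of $I^t$, and $\operatorname{astab}(I)$ (the index of stability) is the smallest number $t_0\ge 1$ such that $\operatorname{Ass}(I^t)=\operatorname{Ass}(I^{t+1})$ for all $t\ge t_0$. For a simple graph $C$ (regarded as a weighted graph with all vertex weights equal to $1$), $\nu(C)$ is the usual matching number (maximal number of pairwise disjoint edges), and $C$ is strongly $s$-saturating if $\nu(C)<s$ and $\nu(C-j)\ge s-1$ for every vertex $j$ of $C$, where $C-j$ is obtained by deleting the vertex $j$. Let $U\subseteq V$ be such that each connected component of the induced subgraph $\Gamma_U$ contains at least one odd cycle. Set $s(U)=|U|-\sum_{i=1}^m s_i+1$, where $m$ is the number of connected components of $\Gamma_U$ and $s_i$ is the largest number such that the $i$-th component (in some order) contains, as a (not necessarily induced) subgraph, a strongly $s_i$-saturating graph on $2s_i-1$ vertices. Then $s(\Gamma)$ is the maximum of all such $s(U)$, where one sets $s(\Gamma)=1$ if $\Gamma$ is bipartite. *)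

theory Defs
  imports
    "HOL-Library.Poly_Mapping"
    "HOL-Library.Disjoint_Sets"
    "HOL-Algebra.Ideal_Product"
    "HOL-Algebra.Algebraic_Closure_Type"
    "Graph_Theory.Digraph_Component"
begin

section \<open>Polynomial rings, edge ideals, associated primes\<close>

text \<open>
  A polynomial is a finitely supported map from exponent vectors to coefficients. The ring over
  the variables in \<open>V\<close> consists of the polynomials all of whose monomials involve only
  variables from \<open>V\<close>, with the operations of the type class instance.
\<close>

definition mpoly_ring :: "'a set \<Rightarrow> (('a \<Rightarrow>\<^sub>0 nat) \<Rightarrow>\<^sub>0 'k::field) ring" where
  "mpoly_ring V = ring_of_type_algebra
     \<lparr>carrier := {p. \<forall>m \<in> Poly_Mapping.keys p. Poly_Mapping.keys m \<subseteq> V}\<rparr>"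

definition var :: "'a \<Rightarrow> (('a \<Rightarrow>\<^sub>0 nat) \<Rightarrow>\<^sub>0 'k::field)" where
  "var i = Poly_Mapping.single (Poly_Mapping.single i 1) 1"

lemma var_in_carrier: "i \<in> V \<Longrightarrow> var i \<in> carrier (mpoly_ring V)"
  by (simp add: mpoly_ring_def var_def)

lemma cring_mpoly_ring: "cring (mpoly_ring V :: (('a \<Rightarrow>\<^sub>0 nat) \<Rightarrow>\<^sub>0 'k::field) ring)"
proof -
  let ?T = "ring_of_type_algebra :: (('a \<Rightarrow>\<^sub>0 nat) \<Rightarrow>\<^sub>0 'k) ring"
  let ?S = "{p :: ('a \<Rightarrow>\<^sub>0 nat) \<Rightarrow>\<^sub>0 'k. \<forall>m \<in> Poly_Mapping.keys p. Poly_Mapping.keys m \<subseteq> V}"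
  interpret T: cring ?T
    by (rule cring_from_type_algebra)
  have neg: "\<ominus>\<^bsub>?T\<^esub> p = - p" for p
    by (rule T.minus_equality) (simp_all add: ring_of_type_algebra_def)
  have mult: "p * q \<in> ?S" if "p \<in> ?S" "q \<in> ?S" for p q
  proof (intro CollectI ballI)
    fix m assume "m \<in> Poly_Mapping.keys (p * q)"
    then obtain a b where "m = a + b" "a \<in> Poly_Mapping.keys p" "b \<in> Poly_Mapping.keys q"
      using keys_mult[of p q] by blast
    with that Poly_Mapping.keys_add[of a b] show "Poly_Mapping.keys m \<subseteq> V"
      by blast
  qed
  have add: "p + q \<in> ?S" if "p \<in> ?S" "q \<in> ?S" for p q
    using that Poly_Mapping.keys_add[of p q] by blast
  have "subcring ?S ?T"
  proof (rule T.subcringI', rule T.subringI)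
    show "\<ominus>\<^bsub>?T\<^esub> p \<in> ?S" if "p \<in> ?S" for p
      using that by (simp add: neg)
    show "p \<otimes>\<^bsub>?T\<^esub> q \<in> ?S" if "p \<in> ?S" "q \<in> ?S" for p q
      using mult[OF that] by (simp add: ring_of_type_algebra_def)
    show "p \<oplus>\<^bsub>?T\<^esub> q \<in> ?S" if "p \<in> ?S" "q \<in> ?S" for p q
      using add[OF that] by (simp add: ring_of_type_algebra_def)
  qed (simp_all add: ring_of_type_algebra_def)
  then show ?thesis
    using T.subcring_iff[of ?S] by (simp add: mpoly_ring_def ring_of_type_algebra_def)
qed

definition Ass :: "('r, 'm) ring_scheme \<Rightarrow> 'r set \<Rightarrow> 'r set set" where
  "Ass R J = {P. primeideal P R \<and> (\<exists>f \<in> carrier R. P = {g \<in> carrier R. g \<otimes>\<^bsub>R\<^esub> f \<in> J})}"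

definition astab :: "('r, 'm) ring_scheme \<Rightarrow> 'r set \<Rightarrow> nat" where
  "astab R I = (LEAST t0. t0 \<ge> 1 \<and>
     (\<forall>t \<ge> t0. Ass R (I [^]\<^bsub>ideals_set R\<^esub> t) = Ass R (I [^]\<^bsub>ideals_set R\<^esub> (t + 1))))"


section \<open>Simple graphs\<close>

text \<open>
  Simple graphs are rendered by the locale \<^locale>\<open>graph\<close>: finite symmetric digraphs without
  loops and parallel arcs. An undirected edge is thus a pair of opposite arcs, and the strongly
  connected components \<^const>\<open>pre_digraph.sccs\<close> are the connected components. A directed cycle may
  run back and forth along one edge; such a cycle has length 2, so the cycles of odd length are
  exactly the odd cycles of the simple graph.
\<close>

definition edges :: "('a, 'b) pre_digraph \<Rightarrow> 'a set set" where
  "edges G = {{u, v} | u v. u \<rightarrow>\<^bsub>G\<^esub> v}"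

definition bipartite :: "('a, 'b) pre_digraph \<Rightarrow> bool" where
  "bipartite G \<longleftrightarrow> (\<exists>A B. A \<union> B = verts G \<and> A \<inter> B = {} \<and>
     (\<forall>e \<in> edges G. \<exists>a \<in> A. \<exists>b \<in> B. e = {a, b}))"

definition matching_number :: "('a, 'b) pre_digraph \<Rightarrow> nat" where
  "matching_number G = Max (card ` {M. M \<subseteq> edges G \<and> disjoint M})"

definition strongly_saturating :: "nat \<Rightarrow> ('a, 'b) pre_digraph \<Rightarrow> bool" where
  "strongly_saturating s C \<longleftrightarrow> matching_number C < s \<and>
     (\<forall>j \<in> verts C. matching_number (pre_digraph.del_vert C j) \<ge> s - 1)"

definition has_odd_cycle :: "('a, 'b) pre_digraph \<Rightarrow> bool" where
  "has_odd_cycle H \<longleftrightarrow> (\<exists>p. pre_digraph.cycle H p \<and> odd (length p))"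

text \<open>
  The number \<open>s\<^sub>i\<close> of a component \<open>H\<close>. The truncated subtractions are harmless, since no graph is
  strongly 0-saturating.
\<close>

definition sat_number :: "('a, 'b) pre_digraph \<Rightarrow> nat" where
  "sat_number H = Max {s. \<exists>C. graph C \<and> subgraph C H \<and>
     card (verts C) = 2 * s - 1 \<and> strongly_saturating s C}"

definition s_subset :: "('a, 'b) pre_digraph \<Rightarrow> 'a set \<Rightarrow> int" where
  "s_subset G U =
     int (card U) - (\<Sum>H \<in> pre_digraph.sccs (G \<restriction> U). int (sat_number H)) + 1"

definition s_graph :: "('a, 'b) pre_digraph \<Rightarrow> int" where
  "s_graph G = (if bipartite G then 1
     else Max {s_subset G U | U. U \<subseteq> verts G \<and>
       (\<forall>H \<in> pre_digraph.sccs (G \<restriction> U). has_odd_cycle H)})"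

definition edge_ideal :: "('a, 'b) pre_digraph \<Rightarrow> (('a \<Rightarrow>\<^sub>0 nat) \<Rightarrow>\<^sub>0 'k::field) set" where
  "edge_ideal G =
     Idl\<^bsub>mpoly_ring (verts G)\<^esub> {var i * var j | i j. {i, j} \<in> edges G}"

end

theory Submission
  imports Defs "HOL-Library.Multiset"
begin

text \<open>
  Since \<open>I\<^sup>t\<close> is a monomial ideal, its associated primes are the ideals \<open>P\<^sub>F = (x\<^sub>i | i \<in> F)\<close> that arise
  as \<open>I\<^sup>t : m\<close> for a monomial \<open>m\<close>. Let \<open>F\<^sub>0\<close> be the set of the vertices of \<open>F\<close> all of whose neighbours lie
  in \<open>F\<close>. For \<open>t \<ge> s(\<Gamma>)\<close> the ideal \<open>P\<^sub>F\<close> is associated to \<open>I\<^sup>t\<close> if and only if \<open>F\<close> is a vertex cover and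
  every component of \<open>\<Gamma>\<close> induced on \<open>F\<^sub>0\<close> has an odd cycle, a condition independent of \<open>t\<close>.

  Necessity (for every \<open>t\<close>) is an argument of Gallai type: \<open>m\<close> yields a weight on \<open>F\<^sub>0\<close> whose maximum
  edge packing grows when the weight of any vertex is increased by one, so every vertex of \<open>F\<^sub>0\<close> has
  a neighbour \<open>j\<close> missed by some maximum packing. Two adjacent missed vertices are joined by an
  alternating path of even length, which together with the edge is an odd closed walk.

  For sufficiency, a factor-critical subgraph with \<open>2s - 1\<close> vertices gives a weight of total degree
  \<open>2s - 1\<close> for which the removal of any one vertex leaves a product of \<open>s - 1\<close> edges. This property
  persists when a vertex \<open>v\<close> adjacent to \<open>p\<close> is added and the weight is multiplied by \<open>x\<^sub>p x\<^sub>v\<close>, so it can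
  be spread over a whole component \<open>H\<close> with \<open>|H| - s\<close> edges. The product over all components of
  \<open>F\<^sub>0\<close>, multiplied by the variables outside \<open>F\<close>, is the required monomial.
\<close>

section \<open>Packings of edges and alternating paths\<close>

definition edge_deg :: "'a set multiset \<Rightarrow> 'a \<Rightarrow> nat" where
  "edge_deg M x = size (filter_mset (\<lambda>e. x \<in> e) M)"

text \<open>Such an \<open>M\<close> of size \<open>t\<close> exists exactly when the monomial with
  exponents \<open>m\<close> lies in the \<open>t\<close>-th power of the edge ideal:
  \<open>M\<close> lists, with repetitions, generators whose product divides it.\<close>

definition packing :: "'a set set \<Rightarrow> ('a \<Rightarrow> nat) \<Rightarrow> 'a set multiset \<Rightarrow> bool" where
  "packing E m M \<longleftrightarrow> set_mset M \<subseteq> E \<and> (\<forall>x. edge_deg M x \<le> m x)"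

definition adj :: "'a set set \<Rightarrow> 'a rel" where
  "adj E = {(u, v). {u, v} \<in> E}"

definition simple_edges :: "'a set set \<Rightarrow> bool" where
  "simple_edges E \<longleftrightarrow> (\<forall>e \<in> E. \<exists>u v. u \<noteq> v \<and> e = {u, v})"

lemma edge_deg_empty [simp]: "edge_deg {#} x = 0"
  by (simp add: edge_deg_def)

lemma edge_deg_add_mset [simp]: "edge_deg (add_mset e M) x = edge_deg M x + of_bool (x \<in> e)"
  by (simp add: edge_deg_def)

lemma edge_deg_union [simp]: "edge_deg (M + N) x = edge_deg M x + edge_deg N x"
  by (simp add: edge_deg_def)

lemma edge_deg_remove:
  assumes "e \<in># M"
  shows "edge_deg M x = edge_deg (M - {#e#}) x + of_bool (x \<in> e)"
  using assms by (metis edge_deg_add_mset insert_DiffM)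

lemma edge_deg_mono: "N \<subseteq># M \<Longrightarrow> edge_deg N x \<le> edge_deg M x"
  unfolding edge_deg_def by (intro size_mset_mono multiset_filter_mono)

lemma edge_deg_less_obtains:
  assumes "edge_deg N b < edge_deg M b"
  obtains e where "e \<in># M - N" "b \<in> e"
proof -
  have "filter_mset (\<lambda>e. b \<in> e) (M - N) \<noteq> {#}"
  proof
    assume "filter_mset (\<lambda>e. b \<in> e) (M - N) = {#}"
    then have "filter_mset (\<lambda>e. b \<in> e) M \<subseteq># filter_mset (\<lambda>e. b \<in> e) N"
      by (simp add: filter_diff_mset Diff_eq_empty_iff_mset)
    then show False
      using assms size_mset_mono unfolding edge_deg_def by (metis not_le)
  qed
  then obtain e where "e \<in># filter_mset (\<lambda>e. b \<in> e) (M - N)"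
    by (rule multiset_nonemptyE)
  then show thesis
    using that[of e] by (simp del: filter_diff_mset)
qed

lemma packing_subset: "packing E m M \<Longrightarrow> N \<subseteq># M \<Longrightarrow> packing E m N"
  unfolding packing_def by (meson edge_deg_mono le_trans mset_subset_eqD subset_eq)

lemma packing_truncate:
  assumes "packing E m M" "k \<le> size M"
  obtains N where "packing E m N" "size N = k"
proof -
  obtain xs where xs: "M = mset xs" by (metis ex_mset)
  have "mset (take k xs) \<subseteq># M"
    unfolding xs by (metis append_take_drop_id mset_append mset_subset_eq_add_left)
  moreover have "size (mset (take k xs)) = k"
    using assms(2) xs by simp
  ultimately show thesis
    using assms(1) that packing_subset by blast
qed

text \<open>If both ends of \<open>e\<close> had spare weight, \<open>e\<close> could be added to
  \<open>N\<close>, against maximality. So the neighbours of an exposed vertex are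
  saturated.\<close>

lemma packing_extend_at:
  assumes N: "packing E m N" and e: "e \<in> E" "e = {b, k}"
    and b: "edge_deg N b < m b" and big: "\<And>M. packing E m M \<Longrightarrow> size M \<le> size N"
  shows "edge_deg N k = m k"
proof (rule ccontr)
  assume "edge_deg N k \<noteq> m k"
  with N have "edge_deg N k < m k"
    by (metis le_neq_implies_less packing_def)
  with N e b have "packing E m (add_mset e N)"
    by (auto simp: packing_def of_bool_def)
  from big[OF this] show False by simp
qed

text \<open>
  This is the alternating path starting at the exposed vertex \<open>b\<close> in the symmetric difference of two
  maximum packings; \<open>A\<close> and \<open>B\<close> are its edges in the two packings.
\<close>
lemma alternating_path:
  assumes E: "simple_edges E" and M: "packing E m M" "size M = k"
    and big: "\<And>M. packing E m M \<Longrightarrow> size M \<le> k"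
    and "packing E m N" "size N = k" "edge_deg N b < m b"
  shows "\<exists>z A B n. A \<subseteq># M - N \<and> B \<subseteq># N - M \<and> size A = size B \<and>
    (\<forall>x. edge_deg A x + of_bool (x = z) = edge_deg B x + of_bool (x = b)) \<and>
    edge_deg M z < m z \<and> (b, z) \<in> adj E ^^ (2 * n)"
  using assms(5-)
proof (induction "size (M - N)" arbitrary: N b rule: less_induct)
  case less
  note N = less.prems(1,2) and b = less.prems(3)
  show ?case
  proof (cases "edge_deg M b < m b")
    case True
    \<comment> \<open>\<open>b\<close> is exposed by \<open>M\<close> as well, so the path ends at
      once with \<open>z = b\<close>.\<close>
    show ?thesis
      by (rule exI[of _ b], rule exI[of _ "{#}"], rule exI[of _ "{#}"], rule exI[of _ 0])
        (use True in auto)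
  next
    case False
    with M have Mb: "edge_deg M b = m b"
      by (meson le_neq_implies_less packing_def)
    then obtain e where e: "e \<in># M - N" "b \<in> e"
      using b edge_deg_less_obtains by metis
    then have ecount: "count N e < count M e"
      by (simp add: in_diff_count)
    have eM: "e \<in># M" using e(1) by (rule in_diffD)
    then have eE: "e \<in> E" using M by (auto simp: packing_def)
    with E e(2) obtain c where c: "e = {b, c}" "c \<noteq> b"
      unfolding simple_edges_def by (metis doubleton_eq_iff insertE singletonD)
    have Nc: "edge_deg N c = m c"
      using packing_extend_at[OF N(1) eE c(1) b] big N(2) by simp
    \<comment> \<open>\<open>N\<close> saturates \<open>c\<close> while \<open>M\<close> without
      \<open>e\<close> does not, so the path continues from \<open>c\<close> along an edge of
      \<open>N\<close>.\<close>
    have "edge_deg (M - {#e#}) c < edge_deg N c"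
    proof -
      have "edge_deg M c \<le> m c" using M by (simp add: packing_def)
      then show ?thesis using edge_deg_remove[OF eM, of c] Nc c by simp
    qed
    then obtain e' where e': "e' \<in># N - (M - {#e#})" "c \<in> e'"
      using edge_deg_less_obtains by metis
    then have e'c: "count (M - {#e#}) e' < count N e'"
      by (simp add: in_diff_count)
    have e'e: "e' \<noteq> e"
      using e'c ecount by auto
    with e'c have e'count: "count M e' < count N e'"
      by simp
    then have e'N: "e' \<in># N" by (metis count_greater_zero_iff gr_zeroI not_less_zero)
    then have e'E: "e' \<in> E" using N by (auto simp: packing_def)
    with E e'(2) obtain l where l: "e' = {c, l}" "c \<noteq> l"
      unfolding simple_edges_def by (metis doubleton_eq_iff insertE singletonD)
    have lb: "l \<noteq> b" using l c e'e by auto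
    \<comment> \<open>Exchanging the two path edges at \<open>c\<close> moves one unit of free
      weight from \<open>b\<close> to \<open>l\<close>. As \<open>N'\<close> shares one more edge
      with \<open>M\<close>, the induction continues from \<open>l\<close>.\<close>
    define N' where "N' = add_mset e (N - {#e'#})"
    have deg': "edge_deg N' x + of_bool (x = l) = edge_deg N x + of_bool (x = b)" for x
      using edge_deg_remove[OF e'N, of x] c l lb by (auto simp: N'_def of_bool_def)
    have "edge_deg N' x \<le> m x" for x
      using deg'[of x] N(1) b unfolding packing_def
      by (cases "x = b") (auto simp: of_bool_def split: if_splits dest: spec[of _ x])
    then have "packing E m N'"
      using N(1) eE by (auto simp: packing_def N'_def dest: in_diffD)
    moreover have "size N' = k"
      using N(2) e'N by (simp add: N'_def size_Suc_Diff1)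
    moreover have "edge_deg N' l < m l"
      using deg'[of l] lb N(1) unfolding packing_def by simp (metis less_eq_Suc_le)
    moreover have MN': "M - N' = (M - N) - {#e#}"
      using e'count e'e by (intro multiset_eqI) (auto simp: N'_def)
    moreover have NM': "N' - M = (N - M) - {#e'#}"
      using ecount e'e by (intro multiset_eqI) (auto simp: N'_def)
    moreover have "size (M - N - {#e#}) < size (M - N)"
      using e(1) by (rule size_Diff1_less)
    ultimately obtain z A B n where IH: "A \<subseteq># (M - N) - {#e#}" "B \<subseteq># (N - M) - {#e'#}"
      "size A = size B" "\<And>x. edge_deg A x + of_bool (x = z) = edge_deg B x + of_bool (x = l)"
      "edge_deg M z < m z" "(l, z) \<in> adj E ^^ (2 * n)"
      using less.hyps[of N' l] by metis
    have e'NM: "e' \<in># N - M" using e'count by (simp add: in_diff_count)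
    have "(b, l) \<in> adj E ^^ 2"
      using eE e'E c l by (auto simp: adj_def numeral_2_eq_2 intro!: relcompI[of b c])
    then have "(b, z) \<in> adj E ^^ (2 * Suc n)"
      using IH(6) relcompI[of b l "adj E ^^ 2" z "adj E ^^ (2 * n)"] relpow_add[of 2 "2 * n" "adj E"]
      by (simp only: mult_Suc_right)
    moreover have "add_mset e A \<subseteq># M - N"
      using IH(1) e(1) by (simp add: insert_subset_eq_iff)
    moreover have "add_mset e' B \<subseteq># N - M"
      using IH(2) e'NM by (simp add: insert_subset_eq_iff)
    moreover have "edge_deg (add_mset e A) x + of_bool (x = z) =
      edge_deg (add_mset e' B) x + of_bool (x = b)" for x
      using IH(4)[of x] c l lb by (auto simp: of_bool_def split: if_splits)
    moreover have "size (add_mset e A) = size (add_mset e' B)"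
      using IH(3) by simp
    ultimately show ?thesis
      using IH(5) by blast
  qed
qed

text \<open>The alternating path from \<open>j\<close> ends at a vertex \<open>z\<close> exposed by
  \<open>M\<close>. If \<open>z\<close> differs from \<open>i\<close>, switching \<open>M\<close>
  along the path leaves both \<open>i\<close> and \<open>j\<close> exposed, and adding the edge
  \<open>{i, j}\<close> beats the maximum. So the path, of even length, ends at \<open>i\<close>,
  and the edge closes it to an odd walk.\<close>

lemma odd_closed_walk_of_exposed_edge:
  assumes E: "simple_edges E" and big: "\<And>M. packing E m M \<Longrightarrow> size M \<le> k"
    and M: "packing E m M" "size M = k" "edge_deg M i < m i"
    and N: "packing E m N" "size N = k" "edge_deg N j < m j"
    and ij: "{i, j} \<in> E"
  shows "\<exists>n. (j, j) \<in> adj E ^^ (2 * n + 1)"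
proof -
  obtain z A B n where P: "A \<subseteq># M - N" "B \<subseteq># N - M" "size A = size B"
    "\<And>x. edge_deg A x + of_bool (x = z) = edge_deg B x + of_bool (x = j)"
    "edge_deg M z < m z" "(j, z) \<in> adj E ^^ (2 * n)"
    using alternating_path[OF E M(1,2) big N] by blast
  have "z = i"
  proof (rule ccontr)
    assume zi: "z \<noteq> i"
    have AM: "A \<subseteq># M" using P(1) by (meson diff_subset_eq_self subset_mset.trans)
    then obtain C where C: "M = A + C" by (metis subset_mset.le_iff_add)
    define M' where "M' = add_mset {i, j} (B + C)"
    have "i \<noteq> j" using E ij unfolding simple_edges_def by fastforce
    then have "edge_deg M' x \<le> m x" for x
      using P(4)[of x] P(5) M(3) M(1) zi C unfolding packing_def M'_def
      by (auto simp: of_bool_def split: if_splits dest: spec[of _ x])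
    moreover have "set_mset M' \<subseteq> E"
      using ij M(1) N(1) C P(2) unfolding packing_def M'_def
      by (auto dest!: mset_subset_eqD[OF P(2)] in_diffD)
    ultimately have "size M' \<le> k" using big by (simp add: packing_def)
    then show False using C M(2) P(3) by (simp add: M'_def)
  qed
  with P(6) ij have "(j, j) \<in> adj E ^^ Suc (2 * n)"
    by (auto simp: adj_def insert_commute)
  then show ?thesis by (metis Suc_eq_plus1)
qed

text \<open>Here \<open>k - 1\<close> is the maximum size of a packing for \<open>m\<close>.
  Deleting an edge at \<open>i\<close> from a packing of size \<open>k\<close> for the raised weight
  gives a maximum packing that exposes a neighbour \<open>j\<close>. The same argument at
  \<open>j\<close> exposes a neighbour \<open>l\<close>, and then both ends of the edge
  \<open>{j, l}\<close> are exposed by maximum packings.\<close>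

lemma odd_closed_walk_of_critical:
  assumes E: "simple_edges E" and no: "\<nexists>M. packing E m M \<and> size M = k"
    and crit: "\<And>i. i \<in> S \<Longrightarrow> \<exists>M. packing E (\<lambda>x. m x + of_bool (x = i)) M \<and> size M = k"
    and S: "\<Union> E \<subseteq> S" and i: "i \<in> S"
  shows "\<exists>j n. {i, j} \<in> E \<and> (j, j) \<in> adj E ^^ (2 * n + 1)"
proof -
  have k: "k > 0"
  proof (rule ccontr)
    assume "\<not> k > 0"
    then have "packing E m {#} \<and> size {#} = k" by (simp add: packing_def)
    with no show False by blast
  qed
  have big: "size M \<le> k - 1" if "packing E m M" for M
    using packing_truncate[OF that, of k] no by fastforce
  have nb: "\<exists>j N. {i, j} \<in> E \<and> packing E m N \<and> size N = k - 1 \<and> edge_deg N j < m j"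
    if i: "i \<in> S" for i
  proof -
    obtain M where M: "packing E (\<lambda>x. m x + of_bool (x = i)) M" "size M = k"
      using crit[OF i] by blast
    have le: "edge_deg M x \<le> m x + of_bool (x = i)" for x
      using M(1) by (simp add: packing_def)
    \<comment> \<open>\<open>M\<close> does not fit the weight \<open>m\<close>, so it really uses
      the extra unit and has an edge at \<open>i\<close>.\<close>
    have "\<not> packing E m M" using no M by blast
    then obtain x where "m x < edge_deg M x"
      using M(1) by (auto simp: packing_def not_le)
    with le[of x] have "edge_deg {#} i < edge_deg M i"
      by (cases "x = i") auto
    then obtain e where e: "e \<in># M" "i \<in> e"
      using edge_deg_less_obtains by (metis diff_zero)
    then have eE: "e \<in> E" using M by (auto simp: packing_def)
    with E e(2) obtain j where j: "e = {i, j}" "i \<noteq> j"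
      unfolding simple_edges_def by (metis doubleton_eq_iff insertE singletonD)
    have rem: "edge_deg M x = edge_deg (M - {#e#}) x + of_bool (x \<in> e)" for x
      using edge_deg_remove[OF e(1)] .
    have "edge_deg (M - {#e#}) x \<le> m x" for x
      using rem[of x] le[of x] e(2) by (cases "x = i") auto
    then have "packing E m (M - {#e#})"
      using M(1) by (auto simp: packing_def dest: in_diffD)
    moreover have "edge_deg (M - {#e#}) j < m j"
      using rem[of j] le[of j] j by simp
    moreover have "size (M - {#e#}) = k - 1"
      using M(2) e(1) by (simp add: size_Diff_singleton)
    ultimately show ?thesis using eE j(1) by blast
  qed
  obtain j N where j: "{i, j} \<in> E" "packing E m N" "size N = k - 1" "edge_deg N j < m j"
    using nb[OF i] by blast
  with S have "j \<in> S" by blast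
  then obtain l N' where l: "{j, l} \<in> E" "packing E m N'" "size N' = k - 1" "edge_deg N' l < m l"
    using nb by blast
  have "{l, j} \<in> E" using l(1) by (simp add: insert_commute)
  from odd_closed_walk_of_exposed_edge[OF E big l(2-4) j(2-4) this] j(1)
  show ?thesis by blast
qed


section \<open>Colon ideals in terms of packings\<close>

lemma edge_deg_sum: "finite T \<Longrightarrow> edge_deg (\<Sum>v\<in>T. f v) x = (\<Sum>v\<in>T. edge_deg (f v) x)"
  by (induction T rule: finite_induct) auto

lemma edge_deg_replicate: "edge_deg (replicate_mset n e) x = n * of_bool (x \<in> e)"
  by (induction n) auto

lemma size_le_sum_edge_deg:
  assumes "finite T" "\<And>e. e \<in># M \<Longrightarrow> e \<inter> T \<noteq> {}"
  shows "size M \<le> (\<Sum>v\<in>T. edge_deg M v)"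
  using assms(2)
proof (induction M)
  case (add e M)
  then obtain v where v: "v \<in> e" "v \<in> T" by auto
  have "(1::nat) = (\<Sum>x\<in>{v}. of_bool (x \<in> e))" using v by simp
  also have "\<dots> \<le> (\<Sum>x\<in>T. of_bool (x \<in> e))"
    using v assms(1) by (intro sum_mono2) auto
  finally show ?case using add by (simp add: sum.distrib)
qed simp

lemma edge_deg_pos_iff: "edge_deg M x > 0 \<longleftrightarrow> (\<exists>e. e \<in># M \<and> x \<in> e)"
proof
  assume "edge_deg M x > 0"
  then show "\<exists>e. e \<in># M \<and> x \<in> e"
    using edge_deg_less_obtains[of "{#}" x M] by auto
next
  assume "\<exists>e. e \<in># M \<and> x \<in> e"
  then show "edge_deg M x > 0"
    using edge_deg_remove by fastforce
qed

lemma handshake: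
  assumes "simple_edges E" "set_mset M \<subseteq> E" "finite C" "\<And>e. e \<in># M \<Longrightarrow> e \<subseteq> C"
  shows "(\<Sum>x\<in>C. edge_deg M x) = 2 * size M"
  using assms(2,4)
proof (induction M)
  case (add e M)
  obtain u v where "e = {u, v}" "u \<noteq> v"
    using assms(1) add.prems(1) unfolding simple_edges_def by auto
  then have "card e = 2" by simp
  moreover have "C \<inter> e = e" using add.prems(2)[of e] by auto
  moreover have "(\<Sum>x\<in>C. of_bool (x \<in> e)) = card (C \<inter> e)"
    using assms(3) by (simp add: of_bool_def sum.If_cases)
  ultimately have "(\<Sum>x\<in>C. of_bool (x \<in> e)) = (2::nat)"
    by simp
  then show ?case using add by (simp add: sum.distrib)
qed simp

definition stable_part :: "'a set set \<Rightarrow> 'a set \<Rightarrow> 'a set" where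
  "stable_part E F = {i \<in> F. \<forall>j. {i, j} \<in> E \<longrightarrow> j \<in> F}"

text \<open>
  This expresses \<open>I\<^sup>t : x\<^sup>m = (x\<^sub>i | i \<in> F)\<close>, where \<open>I\<close> is the edge ideal.
\<close>
definition colon_witness :: "'a set set \<Rightarrow> 'a set \<Rightarrow> 'a set \<Rightarrow> nat \<Rightarrow> ('a \<Rightarrow> nat) \<Rightarrow> bool" where
  "colon_witness E V F t m \<longleftrightarrow>
    (\<forall>i\<in>F. \<exists>M. packing E (\<lambda>x. m x + of_bool (x = i)) M \<and> size M = t) \<and>
    (\<forall>h. (\<forall>x. h x \<noteq> 0 \<longrightarrow> x \<in> V - F) \<longrightarrow> (\<nexists>M. packing E (\<lambda>x. m x + h x) M \<and> size M = t))"

text \<open>If \<open>e\<close> avoided \<open>F\<close>, the \<open>t\<close>-th power of its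
  generator would be a monomial in the variables outside \<open>F\<close>, hence not in the prime,
  and yet it would lie in the colon ideal.\<close>

lemma colon_witness_cover:
  assumes "colon_witness E V F t m" "\<Union> E \<subseteq> V" "e \<in> E"
  shows "e \<inter> F \<noteq> {}"
proof
  assume F: "e \<inter> F = {}"
  have "packing E (\<lambda>x. m x + t * of_bool (x \<in> e)) (replicate_mset t e) \<and> size (replicate_mset t e) = t"
    using assms(3) by (auto simp: packing_def edge_deg_replicate)
  moreover have "\<forall>x. t * of_bool (x \<in> e) \<noteq> 0 \<longrightarrow> x \<in> V - F"
    using F assms(2,3) by auto
  ultimately show False
    using assms(1)[unfolded colon_witness_def, THEN conjunct2, rule_format,
      of "\<lambda>x. t * of_bool (x \<in> e)"] by auto
qed

text \<open>
  The vertices of \<open>F\<close> outside the stable part can always be matched into the complement of \<open>F\<close>,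
  which reduces the claim to the subgraph induced by the stable part.
\<close>
lemma colon_witness_odd_closed_walk:
  assumes E: "simple_edges E" and V: "\<Union> E \<subseteq> V" and F: "finite F"
    and wit: "colon_witness E V F t m"
    and S: "S = stable_part E F" and E0: "E0 = {e \<in> E. e \<subseteq> S}" and i: "i \<in> S"
  shows "\<exists>j n. {i, j} \<in> E0 \<and> (j, j) \<in> adj E0 ^^ (2 * n + 1)"
proof -
  note cover = colon_witness_cover[OF wit V]
  \<comment> \<open>\<open>T\<close> consists of the vertices of \<open>F\<close> with a neighbour
    outside \<open>F\<close>. The packing \<open>P\<close> below uses up their whole weight
    \<open>d\<close> along edges to such neighbours, whose weight may be raised freely by
    \<open>h\<close>.\<close>
  define T where "T = F - S"
  define d where "d = (\<Sum>v\<in>T. m v)"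
  have T: "finite T" using F by (simp add: T_def)
  have "\<exists>w. {v, w} \<in> E \<and> w \<notin> F" if "v \<in> T" for v
    using that by (auto simp: T_def S stable_part_def)
  then obtain w where w: "{v, w v} \<in> E" "w v \<notin> F" if "v \<in> T" for v
    by metis
  define h where "h x = (if x \<in> w ` T then d else 0)" for x
  have hW: "\<forall>x. h x \<noteq> 0 \<longrightarrow> x \<in> V - F"
    using w V by (auto simp: h_def split: if_splits)
  have noh: "\<nexists>M. packing E (\<lambda>x. m x + h x) M \<and> size M = t"
    using wit hW unfolding colon_witness_def by blast
  define m0 where "m0 x = (if x \<in> S then m x else 0)" for x
  define P where "P = (\<Sum>v\<in>T. replicate_mset (m v) {v, w v})"
  have degP: "edge_deg P x = (\<Sum>v\<in>T. m v * of_bool (x \<in> {v, w v}))" for x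
    using T by (simp add: P_def edge_deg_sum edge_deg_replicate)
  have sizeP: "size P = d"
    using T by (simp add: P_def d_def size_multiset_sum)
  have PT: "edge_deg P x = (if x \<in> T then m x else 0)" if "x \<in> F" for x
  proof -
    have "edge_deg P x = (\<Sum>v\<in>T. if v = x then m v else 0)"
      unfolding degP using w that by (intro sum.cong) auto
    then show ?thesis using T by simp
  qed
  have PW: "edge_deg P x \<le> h x" if "x \<notin> F" for x
  proof (cases "x \<in> w ` T")
    case True
    have "edge_deg P x \<le> d"
      unfolding degP d_def by (intro sum_mono) auto
    then show ?thesis using True by (simp add: h_def)
  next
    case False
    then have "edge_deg P x = 0"
      unfolding degP using that by (intro sum.neutral) (auto simp: T_def)
    then show ?thesis by simp
  qed
  have PE: "set_mset P \<subseteq> E"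
    using w T by (auto simp: P_def set_mset_sum split: if_splits)
  have P: "packing E (\<lambda>x. m x + h x) P"
    unfolding packing_def
  proof (intro conjI allI)
    show "edge_deg P x \<le> m x + h x" for x
      using PT[of x] PW[of x] by (cases "x \<in> F") auto
  qed (rule PE)
  have dt: "d < t"
  proof (rule ccontr)
    assume "\<not> d < t"
    then obtain M where "packing E (\<lambda>x. m x + h x) M" "size M = t"
      using packing_truncate[OF P, of t] sizeP by auto
    with noh show False by blast
  qed
  have S_F: "S \<subseteq> F" by (auto simp: S stable_part_def)
  \<comment> \<open>The \<open>d\<close> edges of \<open>P\<close> account for \<open>T\<close>, so
    the critical size for the weight \<open>m0\<close> on \<open>S\<close> is
    \<open>t - d\<close>.\<close>
  show ?thesis
  proof (rule odd_closed_walk_of_critical[where m = m0 and k = "t - d" and S = S])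
    show "simple_edges E0" using E by (simp add: simple_edges_def E0)
    show "\<Union> E0 \<subseteq> S" by (auto simp: E0)
    show "\<nexists>M. packing E0 m0 M \<and> size M = t - d"
    proof
      assume "\<exists>M. packing E0 m0 M \<and> size M = t - d"
      then obtain M where M: "packing E0 m0 M" "size M = t - d" by blast
      have "edge_deg (M + P) x \<le> m x + h x" for x
      proof -
        have "edge_deg M x \<le> m0 x" using M(1) by (simp add: packing_def)
        then show ?thesis
          using PT[of x] PW[of x] S_F by (cases "x \<in> F"; cases "x \<in> S") (auto simp: m0_def T_def)
      qed
      then have "packing E (\<lambda>x. m x + h x) (M + P)"
        using M(1) PE by (auto simp: packing_def E0)
      moreover have "size (M + P) = t" using M(2) sizeP dt by simp
      ultimately show False using noh by blast
    qed
    show "\<exists>M. packing E0 (\<lambda>x. m0 x + of_bool (x = i)) M \<and> size M = t - d" if i: "i \<in> S" for i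
    proof -
      obtain M where M: "packing E (\<lambda>x. m x + of_bool (x = i)) M" "size M = t"
        using wit i S_F unfolding colon_witness_def by blast
      define M0 where "M0 = filter_mset (\<lambda>e. e \<subseteq> S) M"
      define M1 where "M1 = filter_mset (\<lambda>e. \<not> e \<subseteq> S) M"
      have M01: "M = M0 + M1" by (simp add: M0_def M1_def)
      \<comment> \<open>Suppose an edge not inside \<open>S\<close> avoids \<open>T\<close>. It
        meets the cover \<open>F\<close>, necessarily in \<open>S\<close>, so its other end lies in
        \<open>F\<close> and, avoiding \<open>T\<close>, in \<open>S\<close> as well: a
        contradiction. Hence at most \<open>d\<close> edges of \<open>M\<close> are not inside
        \<open>S\<close>.\<close>
      have "e \<inter> T \<noteq> {}" if e: "e \<in># M1" for e
      proof -
        have eE: "e \<in> E" and "\<not> e \<subseteq> S" using e M(1) by (auto simp: M1_def packing_def)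
        obtain u v where uv: "e = {u, v}" using E eE by (auto simp: simple_edges_def)
        then have "{v, u} \<in> E" "{u, v} \<in> E" using eE by (auto simp: insert_commute)
        then show ?thesis
          using \<open>\<not> e \<subseteq> S\<close> cover[OF eE] uv unfolding T_def S stable_part_def by blast
      qed
      then have "size M1 \<le> (\<Sum>v\<in>T. edge_deg M1 v)"
        by (intro size_le_sum_edge_deg T)
      also have "\<dots> \<le> d"
        unfolding d_def
      proof (intro sum_mono)
        fix v assume "v \<in> T"
        then have "v \<noteq> i" using i by (auto simp: T_def)
        moreover have "edge_deg M v \<le> m v + of_bool (v = i)"
          using M(1) by (simp add: packing_def)
        ultimately show "edge_deg M1 v \<le> m v" by (simp add: M01)
      qed
      finally have le: "t - d \<le> size M0"
        using M(2) M01 by simp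
      have "edge_deg M0 x \<le> m0 x + of_bool (x = i)" for x
      proof (cases "x \<in> S")
        case True
        have "edge_deg M x \<le> m x + of_bool (x = i)"
          using M(1) by (simp add: packing_def)
        then show ?thesis using True by (simp add: M01 m0_def)
      next
        case False
        then have "\<not> edge_deg M0 x > 0"
          unfolding edge_deg_pos_iff by (auto simp: M0_def)
        then show ?thesis by simp
      qed
      then have "packing E0 (\<lambda>x. m0 x + of_bool (x = i)) M0"
        using M(1) by (auto simp: packing_def E0 M0_def)
      from packing_truncate[OF this le] show ?thesis by metis
    qed
  qed (rule i)
qed

section \<open>Weighted factor-critical sets and their growth\<close>

text \<open>The weighted analogue of a factor-critical graph: one unit of weight removed at any
  vertex of \<open>C\<close> leaves a weight filled exactly by \<open>k\<close> edges. The model is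
  the weight 1 on a factor-critical graph with \<open>2k + 1\<close> vertices.\<close>

definition critical :: "'a set set \<Rightarrow> ('a \<Rightarrow> nat) \<Rightarrow> nat \<Rightarrow> 'a set \<Rightarrow> bool" where
  "critical E f k C \<longleftrightarrow> (\<forall>x. x \<notin> C \<longrightarrow> f x = 0) \<and>
    (\<forall>c\<in>C. \<exists>M. set_mset M \<subseteq> E \<and> size M = k \<and> (\<forall>x. edge_deg M x + of_bool (x = c) = f x))"

lemma criticalE:
  assumes "critical E f k C" "c \<in> C"
  obtains M where "set_mset M \<subseteq> E" "size M = k" "\<And>x. edge_deg M x + of_bool (x = c) = f x"
proof -
  have "\<exists>M. set_mset M \<subseteq> E \<and> size M = k \<and> (\<forall>x. edge_deg M x + of_bool (x = c) = f x)"
    using assms by (simp add: critical_def)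
  then show thesis using that by blast
qed

text \<open>The total weight is \<open>2k + 1\<close>, as \<open>k\<close> edges leave one unit
  over, and every edge consumes two units.\<close>

lemma critical_packing_size:
  assumes E: "simple_edges E" and f: "critical E f k C" and C: "finite C" "C \<noteq> {}"
    and M: "packing E f M"
  shows "size M \<le> k"
proof -
  have sub: "e \<subseteq> C" if N: "\<And>x. edge_deg N x \<le> f x" "e \<in># N" for N e
  proof
    fix x assume "x \<in> e"
    with N(2) have "edge_deg N x > 0" by (auto simp: edge_deg_pos_iff)
    with N(1)[of x] f show "x \<in> C" unfolding critical_def by force
  qed
  obtain c where c: "c \<in> C" using C by blast
  obtain N where N: "set_mset N \<subseteq> E" "size N = k" "\<And>x. edge_deg N x + of_bool (x = c) = f x"
    using criticalE[OF f c] by metis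
  have "edge_deg N x \<le> f x" for x using N(3)[of x] by simp
  from handshake[OF E N(1) C(1) sub[OF this]] N(2)
  have 1: "(\<Sum>x\<in>C. edge_deg N x) = 2 * k" by simp
  have "2 * size M = (\<Sum>x\<in>C. edge_deg M x)"
    using handshake[OF E _ C(1) sub[of M]] M by (simp add: packing_def)
  also have "\<dots> \<le> (\<Sum>x\<in>C. f x)"
    using M by (intro sum_mono) (simp add: packing_def)
  also have "\<dots> = (\<Sum>x\<in>C. edge_deg N x + of_bool (x = c))"
    using N(3) by simp
  also have "\<dots> = 2 * k + 1"
    using 1 c C(1) by (simp add: sum.distrib of_bool_def)
  finally show ?thesis by simp
qed

text \<open>The packing that spares a unit at \<open>c'\<close> still covers \<open>c\<close>, whose
  weight is positive. Its edge at \<open>c\<close> ends at a vertex of positive weight, hence in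
  \<open>C\<close>.\<close>

lemma critical_neighbour:
  assumes E: "simple_edges E" and f: "critical E f k C" and c: "c \<in> C" "c' \<in> C" "c' \<noteq> c"
  shows "\<exists>q\<in>C. {c, q} \<in> E"
proof -
  obtain N where N: "\<And>x. edge_deg N x + of_bool (x = c) = f x"
    using criticalE[OF f c(1)] by metis
  obtain M where M: "set_mset M \<subseteq> E" "\<And>x. edge_deg M x + of_bool (x = c') = f x"
    using criticalE[OF f c(2)] by metis
  have "edge_deg M c > 0"
    using N[of c] M(2)[of c] c(3) by auto
  then obtain e where e: "e \<in># M" "c \<in> e" by (auto simp: edge_deg_pos_iff)
  then have "e \<in> E" using M(1) by auto
  with E e(2) obtain q where q: "e = {c, q}"
    unfolding simple_edges_def by (metis doubleton_eq_iff insertE singletonD)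
  have "edge_deg M q > 0" using e q by (auto simp: edge_deg_pos_iff)
  then have "f q \<noteq> 0" using M(2)[of q] by auto
  then have "q \<in> C" using f by (auto simp: critical_def)
  then show ?thesis using \<open>e \<in> E\<close> q by blast
qed

text \<open>Raises \<open>k\<close> without enlarging \<open>C\<close>, which serves to pad up to a
  prescribed size.\<close>

lemma critical_add_edge:
  assumes f: "critical E f k C" and e: "{u, v} \<in> E" "u \<noteq> v" "u \<in> C" "v \<in> C"
  shows "critical E (\<lambda>x. f x + of_bool (x = u) + of_bool (x = v)) (Suc k) C"
  unfolding critical_def
proof (intro conjI allI impI ballI)
  fix c assume "c \<in> C"
  then obtain M where M: "set_mset M \<subseteq> E" "size M = k" "\<And>x. edge_deg M x + of_bool (x = c) = f x"
    using criticalE[OF f] by metis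
  show "\<exists>M. set_mset M \<subseteq> E \<and> size M = Suc k \<and>
    (\<forall>x. edge_deg M x + of_bool (x = c) = f x + of_bool (x = u) + of_bool (x = v))"
    by (rule exI[of _ "add_mset {u, v} M"])
      (use M e in \<open>auto simp: M(3)[symmetric] of_bool_def\<close>)
qed (use f e in \<open>auto simp: critical_def\<close>)

text \<open>For a unit removed in \<open>C\<close>, add \<open>{p, v}\<close> to the old packing.
  For the unit removed at \<open>v\<close>, take the old packing that spares \<open>q\<close> and
  add \<open>{p, q}\<close>, which fills the spared unit and the new unit at
  \<open>p\<close>.\<close>

lemma critical_insert:
  assumes f: "critical E f k C" and e: "{p, v} \<in> E" "p \<in> C" "v \<notin> C"
    and q: "q \<in> C" "{p, q} \<in> E" "p \<noteq> q"
  shows "critical E (\<lambda>x. f x + of_bool (x = p) + of_bool (x = v)) (Suc k) (insert v C)"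
  unfolding critical_def
proof (intro conjI allI impI ballI)
  fix c assume c: "c \<in> insert v C"
  show "\<exists>M. set_mset M \<subseteq> E \<and> size M = Suc k \<and>
    (\<forall>x. edge_deg M x + of_bool (x = c) = f x + of_bool (x = p) + of_bool (x = v))"
  proof (cases "c = v")
    case False
    then obtain M where M: "set_mset M \<subseteq> E" "size M = k" "\<And>x. edge_deg M x + of_bool (x = c) = f x"
      using c criticalE[OF f, of c] by auto
    show ?thesis
      by (rule exI[of _ "add_mset {p, v} M"])
        (use M e in \<open>auto simp: M(3)[symmetric] of_bool_def\<close>)
  next
    case True
    obtain M where M: "set_mset M \<subseteq> E" "size M = k" "\<And>x. edge_deg M x + of_bool (x = q) = f x"
      using criticalE[OF f q(1)] by auto
    show ?thesis
      by (rule exI[of _ "add_mset {p, q} M"])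
        (use M q True in \<open>auto simp: M(3)[symmetric] of_bool_def\<close>)
  qed
qed (use f e in \<open>auto simp: critical_def\<close>)

text \<open>Connectivity lets the remaining vertices of \<open>H\<close> be attached one at a time,
  each at the cost of one edge; further edges inside \<open>H\<close> then pad up to
  \<open>K\<close>. With two vertices in \<open>C\<close>, the vertex attached to has the neighbour
  in \<open>C\<close> that the insertion requires.\<close>

lemma critical_grow:
  assumes E: "simple_edges E" and f: "critical E f k C" and C: "C \<subseteq> H" "finite H" "2 \<le> card C"
    and conn: "\<And>D. D \<subset> H \<Longrightarrow> D \<noteq> {} \<Longrightarrow> \<exists>p\<in>D. \<exists>v\<in>H - D. {p, v} \<in> E"
    and K: "k + card (H - C) \<le> K"
  shows "\<exists>f. critical E f K H"
proof -
  have two: "\<exists>c'\<in>C. c' \<noteq> c" if "2 \<le> card C" for C and c :: 'a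
  proof (rule ccontr)
    assume "\<not> (\<exists>c'\<in>C. c' \<noteq> c)"
    then have "C \<subseteq> {c}" by auto
    then have "card C \<le> 1" using card_mono[of "{c}" C] by simp
    with that show False by simp
  qed
  have step: "\<exists>f. critical E f (k + card (H - C)) H"
    if "critical E f k C" "C \<subseteq> H" "2 \<le> card C" for f k C
    using that
  proof (induction "card (H - C)" arbitrary: f k C)
    case 0
    then have "C = H" using assms(4) by auto
    then show ?case using 0 by auto
  next
    case (Suc a)
    then have "C \<subset> H" by auto
    moreover have "C \<noteq> {}" using Suc.prems by auto
    ultimately obtain p v where pv: "p \<in> C" "v \<in> H - C" "{p, v} \<in> E"
      using conn by blast
    obtain c' where "c' \<in> C" "c' \<noteq> p" using two Suc.prems(3) by blast
    then obtain q where q: "q \<in> C" "{p, q} \<in> E"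
      using critical_neighbour[OF E Suc.prems(1) pv(1)] by blast
    then have "p \<noteq> q" using E unfolding simple_edges_def by fastforce
    have fin: "finite C" "finite (H - C)" using Suc.prems C(2) finite_subset by auto
    have a: "a = card (H - insert v C)"
      using Suc.hyps(2) pv(2) fin by (metis Diff_insert card_Diff_singleton diff_Suc_1)
    have "critical E (\<lambda>x. f x + of_bool (x = p) + of_bool (x = v)) (Suc k) (insert v C)"
      using critical_insert[OF Suc.prems(1) pv(3,1) _ q \<open>p \<noteq> q\<close>] pv(2) by simp
    moreover have "insert v C \<subseteq> H" "2 \<le> card (insert v C)"
      using pv(2) Suc.prems fin by (auto simp: card_insert_if)
    ultimately have "\<exists>f. critical E f (Suc k + card (H - insert v C)) H"
      using Suc.hyps(1)[OF a] by blast
    moreover have "Suc k + card (H - insert v C) = k + card (H - C)"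
      using a Suc.hyps(2) by simp
    ultimately show ?case by metis
  qed
  have "card C \<le> card H" using C(1,2) by (intro card_mono)
  then have "2 \<le> card H" using C(3) by simp
  then have "H \<noteq> {}" by auto
  then obtain u where u: "u \<in> H" by blast
  obtain u' where u': "u' \<in> H" "u' \<noteq> u" using two[OF \<open>2 \<le> card H\<close>] by blast
  have pad: "\<exists>f. critical E f (k + card (H - C) + l) H" for l
  proof (induction l)
    case 0
    then show ?case using step[OF f C(1,3)] by simp
  next
    case (Suc l)
    then obtain g where g: "critical E g (k + card (H - C) + l) H" by blast
    from critical_neighbour[OF E g u u'] obtain v where v: "v \<in> H" "{u, v} \<in> E" by blast
    then have "u \<noteq> v" using E unfolding simple_edges_def by fastforce
    from critical_add_edge[OF g v(2) this u v(1)] show ?case by auto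
  qed
  from pad[of "K - (k + card (H - C))"] K show ?thesis by simp
qed

text \<open>Allows a closed walk to be read from any starting position.\<close>

lemma sum_periodic_shift:
  fixes g :: "nat \<Rightarrow> nat"
  assumes "\<And>q. g (q + N) = g q"
  shows "(\<Sum>q<N. g (a + q)) = (\<Sum>q<N. g q)"
proof (induction a)
  case (Suc a)
  have "(\<Sum>q<N. g (Suc a + q)) + g a = (\<Sum>q<Suc N. g (a + q))"
    unfolding sum.lessThan_Suc_shift by simp
  also have "\<dots> = (\<Sum>q<N. g (a + q)) + g a"
    using assms[of a] by simp
  finally show ?case using Suc by simp
qed simp

text \<open>The weight counts the visits of the walk. Removing the visit at position
  \<open>a\<close> leaves \<open>2r\<close> consecutive positions, which pair up into
  \<open>r\<close> edges of the walk. Repeated vertices do no harm, since visits are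
  counted.\<close>

lemma critical_odd_closed_walk:
  assumes E: "simple_edges E" and P: "\<And>q. q < 2 * r + 1 \<Longrightarrow> {P q, P (Suc q)} \<in> E"
    "P (2 * r + 1) = P 0"
  shows "critical E (\<lambda>x. \<Sum>q<2 * r + 1. of_bool (x = P q)) r (P ` {..<2 * r + 1})"
proof -
  define N where "N = 2 * r + 1"
  \<comment> \<open>\<open>Q\<close> continues the walk periodically, so that the positions after
    \<open>a\<close> can be numbered without wrapping around.\<close>
  define Q where "Q q = P (q mod N)" for q
  have N: "N > 0" by (simp add: N_def)
  have QE: "{Q q, Q (Suc q)} \<in> E" for q
  proof (cases "Suc (q mod N) = N")
    case True
    then have "Suc q mod N = 0" by (simp add: mod_Suc)
    then have "Q (Suc q) = P (Suc (q mod N))" using True P(2) by (simp add: Q_def N_def)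
    then show ?thesis using P(1)[of "q mod N"] N unfolding Q_def by (metis N_def mod_less_divisor)
  next
    case False
    then have "Suc q mod N = Suc (q mod N)" by (simp add: mod_Suc)
    then show ?thesis using P(1)[of "q mod N"] N unfolding Q_def by (metis N_def mod_less_divisor)
  qed
  have QP: "Q q = P q" if "q < N" for q using that by (simp add: Q_def)
  have per: "Q (q + N) = Q q" for q by (simp add: Q_def)
  have pair: "(\<Sum>l<n. g (2 * l) + g (Suc (2 * l))) = (\<Sum>q<2 * n. g q)" for n and g :: "nat \<Rightarrow> nat"
    by (induction n) auto
  show ?thesis
    unfolding critical_def N_def[symmetric]
  proof (intro conjI allI impI ballI)
    fix c assume "c \<in> P ` {..<N}"
    then obtain a where "a < N" "c = P a" by blast
    then have a: "c = Q a" using QP by simp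
    define M where "M = (\<Sum>l<r. {#{Q (Suc a + 2 * l), Q (Suc a + Suc (2 * l))}#})"
    have "edge_deg M x + of_bool (x = c) = (\<Sum>q<N. of_bool (x = P q))" for x
    proof -
      have "edge_deg M x = (\<Sum>l<r. of_bool (x = Q (Suc a + 2 * l)) + of_bool (x = Q (Suc a + Suc (2 * l))))"
        unfolding M_def edge_deg_sum[OF finite_lessThan]
      proof (intro sum.cong refl)
        fix l
        have "Q (Suc a + 2 * l) \<noteq> Q (Suc a + Suc (2 * l))"
          using QE[of "Suc a + 2 * l"] E unfolding simple_edges_def by fastforce
        then show "edge_deg {#{Q (Suc a + 2 * l), Q (Suc a + Suc (2 * l))}#} x =
          of_bool (x = Q (Suc a + 2 * l)) + of_bool (x = Q (Suc a + Suc (2 * l)))"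
          by (auto simp: of_bool_def)
      qed
      also have "\<dots> = (\<Sum>q<2 * r. of_bool (x = Q (Suc a + q)))"
        by (rule pair)
      finally have "edge_deg M x + of_bool (x = c) = (\<Sum>q<Suc (2 * r). of_bool (x = Q (a + q)))"
        unfolding sum.lessThan_Suc_shift by (simp add: a)
      also have "\<dots> = (\<Sum>q<N. of_bool (x = Q (a + q)))"
        by (simp add: N_def)
      also have "\<dots> = (\<Sum>q<N. of_bool (x = Q q))"
        by (rule sum_periodic_shift) (simp add: per)
      also have "\<dots> = (\<Sum>q<N. of_bool (x = P q))"
        using QP by (intro sum.cong) auto
      finally show ?thesis .
    qed
    moreover have "set_mset M \<subseteq> E"
      using QE by (auto simp: M_def set_mset_sum)
    moreover have "size M = r" by (simp add: M_def size_multiset_sum)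
    ultimately show "\<exists>M. set_mset M \<subseteq> E \<and> size M = r \<and>
      (\<forall>x. edge_deg M x + of_bool (x = c) = (\<Sum>q<N. of_bool (x = P q)))"
      by blast
  qed (auto simp: of_bool_def)
qed

section \<open>Monomials that witness an associated prime\<close>

text \<open>If there are components, each gets a critical weight, the sizes adding up to
  \<open>t - 1\<close>, and each vertex outside \<open>F\<close> gets weight 1. An additional unit
  in \<open>F\<close> allows one more edge. Weight added outside \<open>F\<close> does not help: the
  vertices of \<open>F\<close> outside the stable part have weight 0, so a packing uses only edges
  inside components.\<close>

lemma colon_witness_exists:
  assumes E: "simple_edges E" and V: "\<Union> E \<subseteq> V" "finite V" and F: "F \<subseteq> V"
    and cover: "\<And>e. e \<in> E \<Longrightarrow> e \<inter> F \<noteq> {}"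
    and CC: "disjoint CC" "\<Union> CC = stable_part E F" "\<And>C. C \<in> CC \<Longrightarrow> 2 \<le> card C"
    and comp: "\<And>e. e \<in> E \<Longrightarrow> e \<subseteq> stable_part E F \<Longrightarrow> \<exists>C\<in>CC. e \<subseteq> C"
    and crit: "\<And>C K. C \<in> CC \<Longrightarrow> kk C \<le> K \<Longrightarrow> \<exists>f. critical E f K C"
    and t: "(\<Sum>C\<in>CC. kk C) < t"
  shows "\<exists>m. (\<forall>x. x \<notin> V \<longrightarrow> m x = 0) \<and> colon_witness E V F t m"
proof -
  define S where "S = stable_part E F"
  have SF: "S \<subseteq> F" by (auto simp: S_def stable_part_def)
  have "finite S" by (rule finite_subset[OF SF finite_subset[OF F V(2)]])
  then have fin: "finite CC" using CC(2) by (simp add: S_def finite_UnionD)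
  have finC: "finite C" if "C \<in> CC" for C using CC(3)[OF that] by (auto intro: card_ge_0_finite)
  have "\<exists>w. {v, w} \<in> E \<and> w \<in> V - F" if "v \<in> F - S" for v
    using that V(1) by (auto simp: S_def stable_part_def)
  then obtain w where w: "{v, w v} \<in> E" "w v \<in> V - F" if "v \<in> F - S" for v
    by metis
  show ?thesis
  proof (cases "S = {}")
    case False
    then obtain C0 where C0: "C0 \<in> CC" using CC(2) S_def by auto
    \<comment> \<open>A single component \<open>C0\<close> takes up the surplus, so that the sizes
      add up to exactly \<open>t - 1\<close>.\<close>
    define K where "K C = kk C + (if C = C0 then t - 1 - (\<Sum>C\<in>CC. kk C) else 0)" for C
    have sumK: "(\<Sum>C\<in>CC. K C) = t - 1"
      using C0 fin t by (simp add: K_def sum.distrib)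
    have "\<exists>f. critical E f (K C) C" if "C \<in> CC" for C
      using crit[OF that] by (simp add: K_def)
    then obtain f where f: "critical E (f C) (K C) C" if "C \<in> CC" for C
      by metis
    define m where "m x = (\<Sum>C\<in>CC. f C x) + of_bool (x \<in> V - F)" for x
    have "\<exists>N. set_mset N \<subseteq> E \<and> size N = K C \<and> (\<forall>x. edge_deg N x \<le> f C x)" if C: "C \<in> CC" for C
    proof -
      obtain c where "c \<in> C" using CC(3)[OF C] by fastforce
      from criticalE[OF f[OF C] this] obtain N where
        "set_mset N \<subseteq> E" "size N = K C" "\<And>x. edge_deg N x + of_bool (x = c) = f C x" by metis
      then show ?thesis by (metis le_add1)
    qed
    then obtain N where "\<forall>C\<in>CC. set_mset (N C) \<subseteq> E \<and> size (N C) = K C \<and>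
      (\<forall>x. edge_deg (N C) x \<le> f C x)"
      by metis
    then have N: "set_mset (N C) \<subseteq> E" "size (N C) = K C" "edge_deg (N C) x \<le> f C x"
      if "C \<in> CC" for C x
      using that by auto
    have zero: "m x = 0" if "x \<notin> V" for x
    proof -
      have "x \<notin> C" if "C \<in> CC" for C
        using that \<open>x \<notin> V\<close> CC(2) SF F S_def by blast
      then have "(\<Sum>C\<in>CC. f C x) = 0"
        using f unfolding critical_def by (intro sum.neutral) blast
      then show ?thesis using that by (simp add: m_def)
    qed
    have "\<exists>M. packing E (\<lambda>x. m x + of_bool (x = i)) M \<and> size M = t" if i: "i \<in> F" for i
    proof (cases "i \<in> S")
      case True
      then obtain C1 where C1: "C1 \<in> CC" "i \<in> C1" using CC(2) S_def by blast
      obtain c' where "c' \<in> C1" "c' \<noteq> i"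
      proof -
        have "\<not> C1 \<subseteq> {i}" using CC(3)[OF C1(1)] card_mono[of "{i}" C1] by auto
        then show thesis using that by blast
      qed
      \<comment> \<open>A unit spared at a neighbour \<open>c\<close> in the same component and the
        added unit at \<open>i\<close> together carry the extra edge \<open>{i, c}\<close>.\<close>
      from critical_neighbour[OF E f[OF C1(1)] C1(2) this] obtain c where c: "c \<in> C1" "{i, c} \<in> E"
        by blast
      obtain L where L: "set_mset L \<subseteq> E" "size L = K C1" "\<And>x. edge_deg L x + of_bool (x = c) = f C1 x"
        using criticalE[OF f[OF C1(1)] c(1)] by metis
      define R where "R = (\<Sum>C\<in>CC - {C1}. N C)"
      define M where "M = add_mset {i, c} (L + R)"
      have "edge_deg M x \<le> m x + of_bool (x = i)" for x
      proof -
        have "edge_deg R x \<le> (\<Sum>C\<in>CC - {C1}. f C x)"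
          unfolding R_def using fin N(3) by (subst edge_deg_sum) (auto intro!: sum_mono)
        then have "edge_deg (L + R) x + of_bool (x = c) \<le> (\<Sum>C\<in>CC. f C x)"
          using L(3)[of x] fin C1(1) by (simp add: sum.remove)
        moreover have "(of_bool (x \<in> {i, c}) :: nat) \<le> of_bool (x = i) + of_bool (x = c)"
          by auto
        ultimately show ?thesis unfolding M_def m_def edge_deg_add_mset by linarith
      qed
      moreover have "set_mset M \<subseteq> E"
        using c L(1) N(1) fin by (auto simp: M_def R_def set_mset_sum)
      moreover have "size M = t"
      proof -
        have "size R = (\<Sum>C\<in>CC - {C1}. K C)"
          using N(2) by (simp add: R_def size_multiset_sum)
        then have "size L + size R = t - 1"
          using sumK L(2) fin C1(1) by (simp add: sum.remove)
        then show ?thesis using t by (simp add: M_def)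
      qed
      ultimately show ?thesis unfolding packing_def by blast
    next
      case False
      define R where "R = (\<Sum>C\<in>CC. N C)"
      define M where "M = add_mset {i, w i} R"
      \<comment> \<open>For \<open>i\<close> outside the stable part, the extra edge goes to a
        neighbour outside \<open>F\<close>, which has weight 1.\<close>
      have wi: "{i, w i} \<in> E" "w i \<in> V - F" using w[of i] i False by auto
      have "edge_deg M x \<le> m x + of_bool (x = i)" for x
      proof -
        have "edge_deg R x \<le> (\<Sum>C\<in>CC. f C x)"
          unfolding R_def using fin N(3) by (subst edge_deg_sum) (auto intro!: sum_mono)
        moreover have "(of_bool (x \<in> {i, w i}) :: nat) \<le> of_bool (x = i) + of_bool (x \<in> V - F)"
          using wi by auto
        ultimately show ?thesis unfolding M_def m_def edge_deg_add_mset by linarith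
      qed
      moreover have "set_mset M \<subseteq> E"
        using wi N(1) fin by (auto simp: M_def R_def set_mset_sum)
      moreover have "size M = t"
        using N(2) sumK t by (simp add: M_def R_def size_multiset_sum)
      ultimately show ?thesis unfolding packing_def by blast
    qed
    moreover have "\<nexists>M. packing E (\<lambda>x. m x + h x) M \<and> size M = t"
      if h: "\<forall>x. h x \<noteq> 0 \<longrightarrow> x \<in> V - F" for h
    proof
      assume "\<exists>M. packing E (\<lambda>x. m x + h x) M \<and> size M = t"
      then obtain M where M: "packing E (\<lambda>x. m x + h x) M" "size M = t" by blast
      have SM: "x \<in> S" if "x \<in> F" "m x \<noteq> 0" for x
      proof (rule ccontr)
        assume "x \<notin> S"
        then have "x \<notin> C" if "C \<in> CC" for C using that CC(2) S_def by blast
        then have "(\<Sum>C\<in>CC. f C x) = 0"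
          using f unfolding critical_def by (intro sum.neutral) blast
        with that show False by (simp add: m_def)
      qed
      \<comment> \<open>An edge of \<open>M\<close> has an end in \<open>F\<close>. This end has
        positive weight and so lies in \<open>S\<close>, which puts the other end into
        \<open>F\<close> and then into \<open>S\<close> too.\<close>
      have inC: "\<exists>C\<in>CC. e \<subseteq> C" if e: "e \<in># M" for e
      proof -
        have eE: "e \<in> E" using e M(1) by (auto simp: packing_def)
        have pos: "x \<in> S" if "x \<in> e" "x \<in> F" for x
        proof -
          have "edge_deg M x > 0" using e that by (auto simp: edge_deg_pos_iff)
          moreover have "edge_deg M x \<le> m x + h x" using M(1) by (simp add: packing_def)
          moreover have "h x = 0" using h that by blast
          ultimately show ?thesis using SM that(2) by simp
        qed
        obtain x where x: "x \<in> e" "x \<in> F" using cover[OF eE] by blast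
        then obtain y where y: "e = {x, y}"
          using E eE unfolding simple_edges_def by (metis doubleton_eq_iff insertE singletonD)
        have "y \<in> F" using pos[OF x] eE y by (auto simp: S_def stable_part_def)
        then have "e \<subseteq> S" using pos x y by blast
        then show ?thesis using comp eE S_def by blast
      qed
      have "size (filter_mset (\<lambda>e. e \<subseteq> C) M) \<le> K C" if C: "C \<in> CC" for C
      proof (rule critical_packing_size[OF E f[OF C] finC[OF C]])
        show "C \<noteq> {}" using CC(3)[OF C] by auto
        let ?N = "filter_mset (\<lambda>e. e \<subseteq> C) M"
        have "edge_deg ?N x \<le> f C x" for x
        proof (cases "x \<in> C")
          case True
          have "x \<in> F" using True C CC(2) SF S_def by blast
          then have "h x = 0" using h by blast
          have "f D x = 0" if "D \<in> CC - {C}" for D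
          proof -
            have "x \<notin> D" using that True C CC(1) unfolding disjoint_def by blast
            then show ?thesis using f[of D] that unfolding critical_def by blast
          qed
          then have "(\<Sum>D\<in>CC. f D x) = f C x"
            using fin C by (simp add: sum.remove)
          then have "m x + h x = f C x"
            using \<open>h x = 0\<close> \<open>x \<in> F\<close> by (simp add: m_def)
          moreover have "edge_deg ?N x \<le> edge_deg M x"
            by (rule edge_deg_mono) simp
          moreover have "edge_deg M x \<le> m x + h x" using M(1) by (simp add: packing_def)
          ultimately show ?thesis by simp
        next
          case False
          then have "\<not> edge_deg ?N x > 0" by (auto simp: edge_deg_pos_iff)
          then show ?thesis by simp
        qed
        then show "packing E (f C) ?N"
          using M(1) by (auto simp: packing_def)
      qed
      moreover have "size M \<le> (\<Sum>C\<in>CC. size (filter_mset (\<lambda>e. e \<subseteq> C) M))"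
        using inC
      proof (induction M)
        case (add e M)
        then obtain C where C: "C \<in> CC" "e \<subseteq> C" by auto
        have "size M < (\<Sum>C\<in>CC. size (filter_mset (\<lambda>e. e \<subseteq> C) M)) + 1"
          using add by (simp add: less_Suc_eq_le)
        also have "\<dots> = (\<Sum>D\<in>CC. size (filter_mset (\<lambda>e. e \<subseteq> D) M) + of_bool (D = C))"
          using C fin by (simp add: sum.distrib of_bool_def)
        also have "\<dots> \<le> (\<Sum>C\<in>CC. size (filter_mset (\<lambda>e. e \<subseteq> C) (add_mset e M)))"
          using C by (intro sum_mono) auto
        finally show ?case by simp
      qed simp
      ultimately have "size M \<le> t - 1"
        using sumK sum_mono[of CC "\<lambda>C. size (filter_mset (\<lambda>e. e \<subseteq> C) M)" K] by force
      then show False using M(2) t by simp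
    qed
    ultimately have "colon_witness E V F t m"
      unfolding colon_witness_def by (intro conjI ballI allI impI)
    with zero show ?thesis by (intro exI[of _ m]) simp
  next
    case True
    show ?thesis
    proof (cases "F = {}")
      case F0: True
      \<comment> \<open>With \<open>F\<close> empty there are no edges, so all positive powers of
        the edge ideal vanish and the monomial 1 witnesses the zero ideal.\<close>
      then have "E = {}" using cover by auto
      then have "colon_witness E V F t (\<lambda>_. 0)"
        using F0 t by (auto simp: colon_witness_def packing_def)
      then show ?thesis by (intro exI[of _ "\<lambda>_. 0"]) simp
    next
      case False
      then obtain v where v: "v \<in> F" by blast
      \<comment> \<open>Without components, the \<open>t - 1\<close> edges are supplied by one
        vertex \<open>v\<close> of weight \<open>t - 1\<close>. Vertices outside \<open>F\<close>
        get weight \<open>t\<close> because \<open>w i\<close> may coincide with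
        \<open>w v\<close>.\<close>
      define m where "m x = (t - 1) * of_bool (x = v) + t * of_bool (x \<in> V - F)" for x
      have "\<exists>M. packing E (\<lambda>x. m x + of_bool (x = i)) M \<and> size M = t" if i: "i \<in> F" for i
      proof -
        define M where "M = add_mset {i, w i} (replicate_mset (t - 1) {v, w v})"
        have wi: "{i, w i} \<in> E" "w i \<in> V - F" "{v, w v} \<in> E" "w v \<in> V - F"
          using w i v True by auto
        have "edge_deg M x \<le> m x + of_bool (x = i)" for x
        proof (cases "x \<in> V - F")
          case T: True
          have "edge_deg M x \<le> (t - 1) + 1"
            unfolding M_def edge_deg_add_mset edge_deg_replicate by (intro add_mono) auto
          then show ?thesis using t T by (simp add: m_def)
        next
          case False
          then have "x \<noteq> w i" "x \<noteq> w v" using wi by auto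
          then show ?thesis by (simp add: M_def m_def edge_deg_replicate)
        qed
        moreover have "set_mset M \<subseteq> E" using wi by (auto simp: M_def)
        moreover have "size M = t" using t by (simp add: M_def)
        ultimately show ?thesis unfolding packing_def by blast
      qed
      moreover have "\<nexists>M. packing E (\<lambda>x. m x + h x) M \<and> size M = t"
        if h: "\<forall>x. h x \<noteq> 0 \<longrightarrow> x \<in> V - F" for h
      proof
        assume "\<exists>M. packing E (\<lambda>x. m x + h x) M \<and> size M = t"
        then obtain M where M: "packing E (\<lambda>x. m x + h x) M" "size M = t" by blast
        \<comment> \<open>On \<open>F\<close> only \<open>v\<close> carries weight, and every edge
          meets \<open>F\<close>, so every edge of the packing contains \<open>v\<close>.\<close>
        have "e \<inter> {v} \<noteq> {}" if e: "e \<in># M" for e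
        proof -
          have "e \<in> E" using e M(1) by (auto simp: packing_def)
          then obtain x where x: "x \<in> e" "x \<in> F" using cover by blast
          then have "edge_deg M x > 0" using e by (auto simp: edge_deg_pos_iff)
          moreover have "edge_deg M x \<le> m x + h x" using M(1) by (simp add: packing_def)
          moreover have "h x = 0" using h x by blast
          ultimately have "x = v" using x by (cases "x = v") (auto simp: m_def)
          then show ?thesis using x by blast
        qed
        then have "size M \<le> edge_deg M v"
          using size_le_sum_edge_deg[of "{v}" M] by simp
        also have "\<dots> \<le> m v + h v" using M(1) by (simp add: packing_def)
        also have "\<dots> = t - 1" using h v by (auto simp: m_def)
        finally show False using M(2) t by simp
      qed
      moreover have "m x = 0" if "x \<notin> V" for x
        using that v F by (auto simp: m_def)
      ultimately show ?thesis
        unfolding colon_witness_def by (intro exI[of _ m] conjI ballI allI impI)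
    qed
  qed
qed


section \<open>Associated primes of monomial ideals\<close>

abbreviation keys where "keys \<equiv> Poly_Mapping.keys"
abbreviation lookup where "lookup \<equiv> Poly_Mapping.lookup"
abbreviation single where "single \<equiv> Poly_Mapping.single"

lemma mpoly_ring_simps [simp]:
  "carrier (mpoly_ring V) = {p. \<forall>m\<in>keys p. keys m \<subseteq> V}"
  "x \<otimes>\<^bsub>mpoly_ring V\<^esub> y = x * y" "x \<oplus>\<^bsub>mpoly_ring V\<^esub> y = x + y"
  "\<one>\<^bsub>mpoly_ring V\<^esub> = 1" "\<zero>\<^bsub>mpoly_ring V\<^esub> = 0"
  by (simp_all add: mpoly_ring_def ring_of_type_algebra_def)

lemma a_inv_mpoly_ring:
  fixes p :: "('a \<Rightarrow>\<^sub>0 nat) \<Rightarrow>\<^sub>0 'k::field"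
  assumes "p \<in> carrier (mpoly_ring V)"
  shows "\<ominus>\<^bsub>mpoly_ring V\<^esub> p = - p"
proof -
  interpret cring "mpoly_ring V :: (('a \<Rightarrow>\<^sub>0 nat) \<Rightarrow>\<^sub>0 'k) ring" by (rule cring_mpoly_ring)
  show ?thesis by (rule minus_equality) (use assms in auto)
qed

text \<open>For an up-closed \<open>A\<close> this is a monomial ideal of the ring over
  \<open>V\<close>; \<open>A\<close> itself may contain exponents that involve variables outside
  \<open>V\<close>.\<close>

definition mono_span :: "'a set \<Rightarrow> ('a \<Rightarrow>\<^sub>0 nat) set \<Rightarrow> (('a \<Rightarrow>\<^sub>0 nat) \<Rightarrow>\<^sub>0 'k::field) set" where
  "mono_span V A = {p. \<forall>m\<in>keys p. keys m \<subseteq> V \<and> m \<in> A}"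

definition upclosed :: "('a \<Rightarrow>\<^sub>0 nat) set \<Rightarrow> bool" where
  "upclosed A \<longleftrightarrow> (\<forall>m\<in>A. \<forall>a. a + m \<in> A)"

lemma keys_add_nat: "keys (a + b :: 'a \<Rightarrow>\<^sub>0 nat) = keys a \<union> keys b"
  by (auto simp: in_keys_iff lookup_add)

lemma sum_single: "(\<Sum>m\<in>keys p. single m (lookup p m)) = p"
  by (rule poly_mapping_eqI) (auto simp: lookup_sum lookup_single when_def in_keys_iff)

lemma lookup_times_single:
  fixes p :: "('a \<Rightarrow>\<^sub>0 nat) \<Rightarrow>\<^sub>0 'k::field"
  shows "lookup (single m 1 * p) (m + h) = lookup p h"
proof -
  have "single m 1 * p = (\<Sum>a\<in>keys p. single (m + a) (lookup p a))"
    by (subst sum_single[of p, symmetric]) (simp add: sum_distrib_left mult_single)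
  then show ?thesis
    by (auto simp: lookup_sum lookup_single when_def in_keys_iff)
qed

lemma keys_times_single:
  fixes p :: "('a \<Rightarrow>\<^sub>0 nat) \<Rightarrow>\<^sub>0 'k::field"
  shows "keys (single m 1 * p) = (+) m ` keys p"
proof
  show "keys (single m 1 * p) \<subseteq> (+) m ` keys p"
    using keys_mult[of "single m (1::'k)" p] by auto
  show "(+) m ` keys p \<subseteq> keys (single m 1 * p)"
    by (auto simp: in_keys_iff lookup_times_single)
qed

lemma poly_split:
  fixes p :: "'b \<Rightarrow>\<^sub>0 'k::field"
  obtains q r where "p = q + r" "keys q = keys p \<inter> B" "keys r = keys p - B"
proof -
  define q where "q = Poly_Mapping.mapp (\<lambda>m c. c when m \<in> B) p"
  define r where "r = Poly_Mapping.mapp (\<lambda>m c. c when m \<notin> B) p"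
  have "p = q + r"
    by (rule poly_mapping_eqI) (auto simp: q_def r_def lookup_add lookup_mapp when_def in_keys_iff)
  moreover have "keys q = keys p \<inter> B" "keys r = keys p - B"
    by (auto simp: q_def r_def lookup_mapp when_def in_keys_iff split: if_splits)
  ultimately show thesis by (rule that)
qed

lemma ideal_mono_span:
  assumes "upclosed A"
  shows "ideal (mono_span V A) (mpoly_ring V :: (('a \<Rightarrow>\<^sub>0 nat) \<Rightarrow>\<^sub>0 'k::field) ring)"
proof -
  interpret cring "mpoly_ring V :: (('a \<Rightarrow>\<^sub>0 nat) \<Rightarrow>\<^sub>0 'k) ring" by (rule cring_mpoly_ring)
  have mult: "x * a \<in> mono_span V A"
    if "a \<in> mono_span V A" "x \<in> carrier (mpoly_ring V)" for a x :: "('a \<Rightarrow>\<^sub>0 nat) \<Rightarrow>\<^sub>0 'k"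
    unfolding mono_span_def
  proof (intro CollectI ballI)
    fix m assume "m \<in> keys (x * a)"
    then obtain b c where "m = b + c" "b \<in> keys x" "c \<in> keys a"
      using keys_mult[of x a] by blast
    then show "keys m \<subseteq> V \<and> m \<in> A"
      using that assms by (auto simp: mono_span_def upclosed_def keys_add_nat)
  qed
  have sub: "mono_span V A \<subseteq> carrier (mpoly_ring V :: (('a \<Rightarrow>\<^sub>0 nat) \<Rightarrow>\<^sub>0 'k) ring)"
    by (auto simp: mono_span_def)
  show ?thesis
  proof (rule idealI)
    show "subgroup (mono_span V A) (add_monoid (mpoly_ring V :: (('a \<Rightarrow>\<^sub>0 nat) \<Rightarrow>\<^sub>0 'k) ring))"
    proof (rule add.subgroupI)
      show "mono_span V A \<subseteq> carrier (mpoly_ring V :: (('a \<Rightarrow>\<^sub>0 nat) \<Rightarrow>\<^sub>0 'k) ring)" by (rule sub)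
      have "0 \<in> mono_span V A" by (simp add: mono_span_def)
      then show "mono_span V A \<noteq> ({} :: (('a \<Rightarrow>\<^sub>0 nat) \<Rightarrow>\<^sub>0 'k) set)" by blast
      show "\<ominus>\<^bsub>mpoly_ring V\<^esub> a \<in> mono_span V A" if "a \<in> mono_span V A"
        for a :: "('a \<Rightarrow>\<^sub>0 nat) \<Rightarrow>\<^sub>0 'k"
      proof -
        have "a \<in> carrier (mpoly_ring V)" using sub that by blast
        then show ?thesis using that by (simp add: a_inv_mpoly_ring mono_span_def)
      qed
      show "a \<oplus>\<^bsub>mpoly_ring V\<^esub> b \<in> mono_span V A" if "a \<in> mono_span V A" "b \<in> mono_span V A"
        for a b :: "('a \<Rightarrow>\<^sub>0 nat) \<Rightarrow>\<^sub>0 'k"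
        using that Poly_Mapping.keys_add[of a b] unfolding mono_span_def by auto
    qed
    show "x \<otimes>\<^bsub>mpoly_ring V\<^esub> a \<in> mono_span V A"
      if "a \<in> mono_span V A" "x \<in> carrier (mpoly_ring V)" for a x :: "('a \<Rightarrow>\<^sub>0 nat) \<Rightarrow>\<^sub>0 'k"
      using mult[OF that] by simp
    show "a \<otimes>\<^bsub>mpoly_ring V\<^esub> x \<in> mono_span V A"
      if "a \<in> mono_span V A" "x \<in> carrier (mpoly_ring V)" for a x :: "('a \<Rightarrow>\<^sub>0 nat) \<Rightarrow>\<^sub>0 'k"
      using mult[OF that] by (simp add: mult.commute)
  qed (rule ring_axioms)
qed

lemma ideal_mpoly_ringD:
  fixes J :: "(('a \<Rightarrow>\<^sub>0 nat) \<Rightarrow>\<^sub>0 'k::field) set"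
  assumes "ideal J (mpoly_ring V)"
  shows "0 \<in> J" "\<And>p q. p \<in> J \<Longrightarrow> q \<in> J \<Longrightarrow> p + q \<in> J"
    "\<And>r p. r \<in> carrier (mpoly_ring V) \<Longrightarrow> p \<in> J \<Longrightarrow> r * p \<in> J"
    "\<And>p q. p \<in> J \<Longrightarrow> q \<in> J \<Longrightarrow> p - q \<in> J"
    "J \<subseteq> carrier (mpoly_ring V)"
proof -
  interpret ideal J "mpoly_ring V" by fact
  show 0: "0 \<in> J" using additive_subgroup.zero_closed[OF additive_subgroup_axioms] by simp
  show add: "p + q \<in> J" if "p \<in> J" "q \<in> J" for p q using additive_subgroup.a_closed[OF additive_subgroup_axioms that] by simp
  show mult: "r * p \<in> J" if "r \<in> carrier (mpoly_ring V)" "p \<in> J" for r p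
    using I_l_closed[OF that(2,1)] by simp
  show "J \<subseteq> carrier (mpoly_ring V)" by (rule a_subset)
  show "p - q \<in> J" if "p \<in> J" "q \<in> J" for p q
  proof -
    have "single 0 (-1) * q \<in> J" using that(2) by (intro mult) auto
    moreover have "single 0 (-1) * q = - q"
      by (metis mult_minus1 single_one single_uminus)
    ultimately show ?thesis using add[OF that(1)] by fastforce
  qed
qed

lemma mono_span_subset_ideal:
  fixes J :: "(('a \<Rightarrow>\<^sub>0 nat) \<Rightarrow>\<^sub>0 'k::field) set"
  assumes J: "ideal J (mpoly_ring V)" and A: "\<And>m. m \<in> A \<Longrightarrow> keys m \<subseteq> V \<Longrightarrow> single m 1 \<in> J"
  shows "mono_span V A \<subseteq> J"
proof
  note J = ideal_mpoly_ringD[OF J]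
  fix p :: "('a \<Rightarrow>\<^sub>0 nat) \<Rightarrow>\<^sub>0 'k" assume p: "p \<in> mono_span V A"
  have sing: "single m (lookup p m) \<in> J" if "m \<in> keys p" for m
  proof -
    have "single 0 (lookup p m) * single m 1 \<in> J"
      using that p by (intro J(3) A) (auto simp: mono_span_def)
    then show ?thesis by (simp add: mult_single)
  qed
  have "(\<Sum>m\<in>B. single m (lookup p m)) \<in> J" if "finite B" "B \<subseteq> keys p" for B
    using that by (induction B rule: finite_induct) (auto intro: J(1,2) sing)
  from this[of "keys p"] show "p \<in> J" by (simp add: sum_single)
qed

text \<open>For \<open>F\<close> inside \<open>V\<close> this is the ideal generated by the
  variables in \<open>F\<close>.\<close>

definition prime_of :: "'a set \<Rightarrow> 'a set \<Rightarrow> (('a \<Rightarrow>\<^sub>0 nat) \<Rightarrow>\<^sub>0 'k::field) set" where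
  "prime_of V F = mono_span V {m. keys m \<inter> F \<noteq> {}}"

lemma upclosed_meets: "upclosed {m. keys m \<inter> F \<noteq> {}}"
  by (auto simp: upclosed_def keys_add_nat)

text \<open>Split both factors into a part in the ideal and a part free of the variables in
  \<open>F\<close>. The product of the free parts is again free of them and lies in the ideal, so it
  is 0, and one free part vanishes. The linear order provides the absence of zero divisors.\<close>

lemma primeideal_prime_of:
  fixes V F :: "'a::linorder set"
  shows "primeideal (prime_of V F) (mpoly_ring V :: (('a \<Rightarrow>\<^sub>0 nat) \<Rightarrow>\<^sub>0 'k::field) ring)"
proof (rule primeidealI)
  let ?R = "mpoly_ring V :: (('a \<Rightarrow>\<^sub>0 nat) \<Rightarrow>\<^sub>0 'k) ring"
  show id: "ideal (prime_of V F) ?R"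
    unfolding prime_of_def by (rule ideal_mono_span[OF upclosed_meets])
  note P = ideal_mpoly_ringD[OF id]
  show "cring ?R" by (rule cring_mpoly_ring)
  have "1 \<notin> (prime_of V F :: (('a \<Rightarrow>\<^sub>0 nat) \<Rightarrow>\<^sub>0 'k) set)" by (simp add: prime_of_def mono_span_def)
  moreover have "1 \<in> carrier ?R" by simp
  ultimately show "carrier ?R \<noteq> prime_of V F" by blast
  fix a b :: "('a \<Rightarrow>\<^sub>0 nat) \<Rightarrow>\<^sub>0 'k"
  assume a: "a \<in> carrier ?R" and b: "b \<in> carrier ?R" and ab: "a \<otimes>\<^bsub>?R\<^esub> b \<in> prime_of V F"
  obtain a1 a2 where a12: "a = a1 + a2" "keys a1 = keys a \<inter> {m. keys m \<inter> F \<noteq> {}}"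
    "keys a2 = keys a - {m. keys m \<inter> F \<noteq> {}}"
    by (rule poly_split)
  obtain b1 b2 where b12: "b = b1 + b2" "keys b1 = keys b \<inter> {m. keys m \<inter> F \<noteq> {}}"
    "keys b2 = keys b - {m. keys m \<inter> F \<noteq> {}}"
    by (rule poly_split)
  have a1: "a1 \<in> prime_of V F" and b1: "b1 \<in> prime_of V F"
    using a12 b12 a b by (auto simp: prime_of_def mono_span_def)
  have "a2 \<in> carrier ?R" using a12 a by auto
  have "b * a1 + a2 * b1 \<in> prime_of V F"
    by (intro P(2) P(3) a1 b1 b) fact
  then have "a * b - (b * a1 + a2 * b1) \<in> prime_of V F"
    using ab by (intro P(4)) simp
  moreover have "a * b - (b * a1 + a2 * b1) = a2 * b2"
    unfolding a12(1) b12(1) by (simp add: algebra_simps)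
  ultimately have "a2 * b2 \<in> prime_of V F" by simp
  moreover have "keys m \<inter> F = {}" if m: "m \<in> keys (a2 * b2)" for m
  proof -
    obtain u v where "m = u + v" "u \<in> keys a2" "v \<in> keys b2"
      using m keys_mult[of a2 b2] by blast
    then show ?thesis using a12(3) b12(3) by (simp add: keys_add_nat Int_Un_distrib2)
  qed
  ultimately have "keys (a2 * b2) = {}" by (auto simp: prime_of_def mono_span_def)
  then have "a2 * b2 = 0" by (metis sum_single sum.empty)
  then have "a2 = 0 \<or> b2 = 0" by simp
  then show "a \<in> prime_of V F \<or> b \<in> prime_of V F"
    using a1 b1 a12(1) b12(1) by auto
qed

text \<open>Multiplication by a monomial translates exponents without cancellation, so the colon
  condition on polynomials reduces to the one on exponents.\<close>

lemma prime_of_in_Ass: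
  fixes V F :: "'a::linorder set"
  assumes m: "keys m \<subseteq> V" and colon: "\<And>h. keys h \<subseteq> V \<Longrightarrow> m + h \<in> A \<longleftrightarrow> keys h \<inter> F \<noteq> {}"
  shows "prime_of V F \<in> Ass (mpoly_ring V :: (('a \<Rightarrow>\<^sub>0 nat) \<Rightarrow>\<^sub>0 'k::field) ring) (mono_span V A)"
  unfolding Ass_def
proof (intro CollectI conjI bexI)
  show "primeideal (prime_of V F) (mpoly_ring V :: (('a \<Rightarrow>\<^sub>0 nat) \<Rightarrow>\<^sub>0 'k) ring)"
    by (rule primeideal_prime_of)
  show "single m 1 \<in> carrier (mpoly_ring V :: (('a \<Rightarrow>\<^sub>0 nat) \<Rightarrow>\<^sub>0 'k) ring)"
    using m by simp
  have "g \<in> prime_of V F \<longleftrightarrow> single m 1 * g \<in> mono_span V A"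
    if "g \<in> carrier (mpoly_ring V)" for g :: "('a \<Rightarrow>\<^sub>0 nat) \<Rightarrow>\<^sub>0 'k"
    using that m colon by (auto simp: prime_of_def mono_span_def keys_times_single keys_add_nat)
  moreover have "prime_of V F \<subseteq> carrier (mpoly_ring V :: (('a \<Rightarrow>\<^sub>0 nat) \<Rightarrow>\<^sub>0 'k) ring)"
    by (auto simp: prime_of_def mono_span_def)
  ultimately show "prime_of V F = {g \<in> carrier (mpoly_ring V :: (('a \<Rightarrow>\<^sub>0 nat) \<Rightarrow>\<^sub>0 'k) ring).
      g \<otimes>\<^bsub>mpoly_ring V\<^esub> single m 1 \<in> mono_span V A}"
    by (auto simp: mult.commute)
qed

text \<open>The order on exponents is compatible with addition, so no other pair of exponents has
  the same sum, and the product of the leading terms is not cancelled.\<close>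

lemma Max_keys_mult:
  fixes p q :: "('a::linorder \<Rightarrow>\<^sub>0 nat) \<Rightarrow>\<^sub>0 'k::field"
  assumes "p \<noteq> 0" "q \<noteq> 0"
  shows "Max (keys p) + Max (keys q) \<in> keys (p * q)"
proof -
  let ?a = "Max (keys p)" and ?b = "Max (keys q)"
  have ne: "keys p \<noteq> {}" "keys q \<noteq> {}" using assms by (metis sum_single sum.empty)+
  then have ab: "?a \<in> keys p" "?b \<in> keys q" by simp_all
  obtain p1 p2 where p: "p = p1 + p2" "keys p1 = keys p \<inter> {?a}" "keys p2 = keys p - {?a}"
    by (rule poly_split)
  obtain q1 q2 where q: "q = q1 + q2" "keys q1 = keys q \<inter> {?b}" "keys q2 = keys q - {?b}"
    by (rule poly_split)
  have p1: "p1 = single ?a (lookup p1 ?a)" and q1: "q1 = single ?b (lookup q1 ?b)"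
    using sum_single[of p1] sum_single[of q1] p(2) q(2) ab by simp_all
  have lt: "u + v \<noteq> ?a + ?b" if "u \<in> keys p" "v \<in> keys q" "u \<noteq> ?a \<or> v \<noteq> ?b" for u v
  proof -
    have "u \<le> ?a" "v \<le> ?b" using that by simp_all
    with that(3) have "u + v < ?a + ?b"
      by (metis add_le_less_mono add_less_le_mono antisym_conv2)
    then show ?thesis by simp
  qed
  have "?a + ?b \<notin> keys (p1 * q2)"
  proof
    assume "?a + ?b \<in> keys (p1 * q2)"
    then obtain u v where "?a + ?b = u + v" "u \<in> keys p1" "v \<in> keys q2"
      using keys_mult[of p1 q2] by blast
    then show False using lt[of u v] p(2) q(3) by auto
  qed
  moreover have "?a + ?b \<notin> keys (p2 * q)"
  proof
    assume "?a + ?b \<in> keys (p2 * q)"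
    then obtain u v where "?a + ?b = u + v" "u \<in> keys p2" "v \<in> keys q"
      using keys_mult[of p2 q] by blast
    then show False using lt[of u v] p(3) by auto
  qed
  moreover have "p * q = p1 * q1 + p1 * q2 + p2 * q"
    using p(1) q(1) by (simp add: algebra_simps)
  moreover have "p1 * q1 = single (?a + ?b) (lookup p1 ?a * lookup q1 ?b)"
    by (subst p1, subst q1) (simp add: mult_single)
  moreover have "lookup p1 ?a \<noteq> 0" "lookup q1 ?b \<noteq> 0"
    using p(2) q(2) ab by (auto simp flip: in_keys_iff)
  ultimately show ?thesis
    by (simp add: in_keys_iff lookup_add)
qed

lemma single_power_in_carrier: "single (l :: 'a \<Rightarrow>\<^sub>0 nat) (1::'k::field) ^ n \<in> carrier (mpoly_ring V)"
  if "keys l \<subseteq> V"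
proof (induction n)
  case (Suc n)
  interpret cring "mpoly_ring V :: (('a \<Rightarrow>\<^sub>0 nat) \<Rightarrow>\<^sub>0 'k) ring" by (rule cring_mpoly_ring)
  have "single l 1 \<in> carrier (mpoly_ring V)" using that by simp
  from m_closed[OF this Suc] show ?case by simp
qed simp

text \<open>
  Comparing leading terms: multiplication by the leading monomial of \<open>g\<close> moves the leading
  monomial of the part of \<open>f\<close> outside the monomial ideal into the ideal, so iterating it
  exhausts \<open>f\<close>.
\<close>
lemma leading_monomial_power:
  fixes f g :: "('a::linorder \<Rightarrow>\<^sub>0 nat) \<Rightarrow>\<^sub>0 'k::field"
  assumes A: "upclosed A" and g: "g \<in> carrier (mpoly_ring V)" "g \<noteq> 0"
    and f: "f \<in> carrier (mpoly_ring V)" "g * f \<in> mono_span V A"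
  shows "\<exists>n. single (Max (keys g)) 1 ^ n * f \<in> mono_span V A"
  using f
proof (induction "card (keys f - A)" arbitrary: f rule: less_induct)
  case less
  note J = ideal_mpoly_ringD[OF ideal_mono_span[OF A, of V]]
  let ?l = "Max (keys g)"
  have "keys g \<noteq> {}" using g by (metis sum_single sum.empty)
  then have l: "?l \<in> keys g" "keys ?l \<subseteq> V" using g(1) by auto
  show ?case
  proof (cases "keys f - A = {}")
    case True
    then have "f \<in> mono_span V A" using less.prems(1) by (auto simp: mono_span_def)
    then show ?thesis by (intro exI[of _ 0]) simp
  next
    case False
    obtain f1 f0 where f01: "f = f1 + f0" "keys f1 = keys f \<inter> A" "keys f0 = keys f - A"
      by (rule poly_split)
    have f1: "f1 \<in> mono_span V A" using f01 less.prems(1) by (auto simp: mono_span_def)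
    have f0: "f0 \<in> carrier (mpoly_ring V)" "f0 \<noteq> 0" using f01 less.prems(1) False by auto
    have "g * f - g * f1 \<in> mono_span V A"
      by (rule J(4)[OF less.prems(2) J(3)[OF g(1) f1]])
    then have gf0: "g * f0 \<in> mono_span V A" by (simp add: f01(1) algebra_simps)
    have "?l + Max (keys f0) \<in> keys (g * f0)"
      by (rule Max_keys_mult) (use g f0 in auto)
    then have lead: "?l + Max (keys f0) \<in> A" using gf0 by (auto simp: mono_span_def)
    define f' where "f' = single ?l 1 * f0"
    have keys': "keys f' = (+) ?l ` keys f0" by (simp add: f'_def keys_times_single)
    have "Max (keys f0) \<in> keys f0"
      by (rule Max_in[OF finite_keys]) (use f01(3) False in simp)
    then have "keys f' - A \<subset> (+) ?l ` keys f0" using lead keys' by blast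
    then have "card (keys f' - A) < card ((+) ?l ` keys f0)"
      by (intro psubset_card_mono) auto
    also have "\<dots> \<le> card (keys f0)" by (rule card_image_le) simp
    finally have "card (keys f' - A) < card (keys f - A)" using f01(3) by simp
    moreover have "f' \<in> carrier (mpoly_ring V)"
      using keys' f0(1) l(2) by (auto simp: keys_add_nat)
    moreover have "g * f' \<in> mono_span V A"
      using J(3)[of "single ?l 1" "g * f0"] gf0 l(2) by (simp add: f'_def algebra_simps)
    ultimately obtain n where n: "single ?l 1 ^ n * f' \<in> mono_span V A"
      using less.hyps by blast
    have "single ?l 1 ^ n * f' + single ?l 1 ^ Suc n * f1 \<in> mono_span V A"
      by (rule J(2)[OF n J(3)[OF single_power_in_carrier[OF l(2)] f1]])
    moreover have "single ?l 1 ^ n * f' + single ?l 1 ^ Suc n * f1 = single ?l 1 ^ Suc n * f"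
      by (simp add: f'_def f01(1) algebra_simps)
    ultimately show ?thesis by metis
  qed
qed

text \<open>\<open>P\<close> is the colon ideal of some \<open>f\<close>. A power of the leading
  monomial of an element of \<open>P\<close> carries \<open>f\<close> into the monomial ideal, so by
  primality the leading monomial is in \<open>P\<close>. Peeling it off shows that \<open>P\<close>
  contains all monomials of its elements and is generated by variables. Thus \<open>P\<close> is the
  intersection of the colon ideals of the monomials of \<open>f\<close>, and being prime it equals
  one of them.\<close>

lemma Ass_mono_spanE:
  fixes V :: "'a::linorder set"
  assumes A: "upclosed A"
    and P: "P \<in> Ass (mpoly_ring V :: (('a \<Rightarrow>\<^sub>0 nat) \<Rightarrow>\<^sub>0 'k::field) ring) (mono_span V A)"
  obtains F m where "F \<subseteq> V" "P = prime_of V F" "keys m \<subseteq> V"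
    "\<And>h. keys h \<subseteq> V \<Longrightarrow> m + h \<in> A \<longleftrightarrow> keys h \<inter> F \<noteq> {}"
proof -
  let ?R = "mpoly_ring V :: (('a \<Rightarrow>\<^sub>0 nat) \<Rightarrow>\<^sub>0 'k) ring"
  from P obtain f where prime: "primeideal P ?R" and f: "f \<in> carrier ?R"
    and Pf: "P = {g \<in> carrier ?R. g \<otimes>\<^bsub>?R\<^esub> f \<in> mono_span V A}"
    unfolding Ass_def by blast
  interpret primeideal P ?R by (rule prime)
  note PI = ideal_mpoly_ringD[OF is_ideal]
  have inP: "g \<in> P \<longleftrightarrow> g * f \<in> mono_span V A" if "g \<in> carrier ?R" for g
    using that Pf by simp
  have one: "1 \<notin> P"
    using I_notcarr PI(3)[of _ 1] PI(5) by auto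
  have pr: "a \<in> P \<or> b \<in> P" if "a \<in> carrier ?R" "b \<in> carrier ?R" "a * b \<in> P" for a b
    using I_prime[OF that(1,2)] that(3) by simp
  have pow: "single l 1 \<in> P" if l: "keys l \<subseteq> V" and n: "single l 1 ^ n \<in> P" for l n
    using n
  proof (induction n)
    case 0
    then show ?case using one by simp
  next
    case (Suc n)
    have "single l 1 \<in> carrier ?R" using l by simp
    from pr[OF this single_power_in_carrier[OF l]] Suc show ?case by auto
  qed
  have mon: "single a 1 \<in> P" if "g \<in> P" "a \<in> keys g" for g a
    using that
  proof (induction "card (keys g)" arbitrary: g rule: less_induct)
    case less
    let ?l = "Max (keys g)"
    have gc: "g \<in> carrier ?R" using less.prems PI(5) by blast
    have l: "?l \<in> keys g" using less.prems(2) by (intro Max_in) auto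
    then have lV: "keys ?l \<subseteq> V" using gc by auto
    have "g \<noteq> 0" using less.prems(2) by auto
    moreover have "g * f \<in> mono_span V A" using inP[OF gc] less.prems(1) by simp
    ultimately obtain n where "single ?l 1 ^ n * f \<in> mono_span V A"
      using leading_monomial_power[OF A gc _ f] by blast
    then have "single ?l 1 ^ n \<in> P" using inP[OF single_power_in_carrier[OF lV]] by simp
    then have lP: "single ?l 1 \<in> P" by (rule pow[OF lV])
    show ?case
    proof (cases "a = ?l")
      case False
      obtain g1 g2 where g12: "g = g1 + g2" "keys g1 = keys g \<inter> {?l}" "keys g2 = keys g - {?l}"
        by (rule poly_split)
      have "g1 = single ?l (lookup g1 ?l)"
        using sum_single[of g1] g12(2) l by simp
      then have "g1 = single 0 (lookup g1 ?l) * single ?l 1" by (simp add: mult_single)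
      moreover have "single 0 (lookup g1 ?l) * single ?l 1 \<in> P"
        by (intro PI(3) lP) auto
      ultimately have "g1 \<in> P" by simp
      then have "g - g1 \<in> P" using less.prems(1) by (rule PI(4)[rotated])
      then have "g2 \<in> P" using g12(1) by simp
      moreover have "card (keys g2) < card (keys g)"
        unfolding g12(3) using l by (intro card_Diff1_less) auto
      moreover have "a \<in> keys g2" using False g12(3) less.prems(2) by simp
      ultimately show ?thesis using less.hyps by blast
    qed (use lP in simp)
  qed
  define F where "F = {i \<in> V. single (single i 1) 1 \<in> P}"
  \<comment> \<open>A monomial is split into a variable and a monomial of smaller degree; primality
    decides that one of the two factors lies in \<open>P\<close>.\<close>
  have monF: "single a 1 \<in> P \<longleftrightarrow> keys a \<inter> F \<noteq> {}" if "keys a \<subseteq> V" for a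
    using that
  proof (induction "sum (lookup a) (keys a)" arbitrary: a rule: less_induct)
    case less
    show ?case
    proof (cases "keys a = {}")
      case True
      then have "a = 0" by (metis keys_eq_empty)
      then show ?thesis using one by simp
    next
      case False
      then obtain i where i: "i \<in> keys a" by blast
      define b where "b = a - single i 1"
      have ab: "a = single i 1 + b"
        using i by (intro poly_mapping_eqI)
          (auto simp: b_def lookup_add lookup_minus lookup_single when_def in_keys_iff)
      have ka: "keys a = insert i (keys b)" by (subst ab) (simp add: keys_add_nat)
      have "sum (lookup b) (keys b) = sum (lookup b) (keys a)"
        unfolding ka by (rule sum.mono_neutral_left) (auto simp: in_keys_iff)
      also have "\<dots> < sum (lookup a) (keys a)"
        using i by (intro sum_strict_mono_ex1)
          (auto simp: b_def lookup_minus lookup_single in_keys_iff intro!: bexI[of _ i])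
      finally have IH: "single b 1 \<in> P \<longleftrightarrow> keys b \<inter> F \<noteq> {}"
        using less ka by auto
      have "single a 1 = single (single i 1) 1 * single b (1::'k)"
        by (simp add: mult_single ab)
      moreover have c: "single (single i 1) 1 \<in> carrier ?R" "single b 1 \<in> carrier ?R"
        using ka less.prems by auto
      ultimately have "single a 1 \<in> P \<longleftrightarrow> single (single i 1) 1 \<in> P \<or> single b 1 \<in> P"
        using pr[OF c] PI(3) by (metis mult.commute)
      moreover have "single (single i 1) 1 \<in> P \<longleftrightarrow> i \<in> F" using i less.prems by (auto simp: F_def)
      ultimately show ?thesis using IH ka by auto
    qed
  qed
  have PF: "P = prime_of V F"
  proof
    show "P \<subseteq> prime_of V F"
    proof
      fix g assume g: "g \<in> P"
      then have "g \<in> carrier ?R" using PI(5) by blast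
      then show "g \<in> prime_of V F"
        using mon[OF g] monF by (auto simp: prime_of_def mono_span_def)
    qed
    show "prime_of V F \<subseteq> P"
      unfolding prime_of_def by (rule mono_span_subset_ideal[OF is_ideal]) (use monF in auto)
  qed
  have colon: "single h 1 \<in> P \<longleftrightarrow> (\<forall>m\<in>keys f. m + h \<in> A)" if "keys h \<subseteq> V" for h
    using inP[of "single h 1"] that f
    by (auto simp: mono_span_def keys_times_single keys_add_nat add.commute)
  have "\<exists>m\<in>keys f. \<forall>h. keys h \<subseteq> V \<longrightarrow> m + h \<in> A \<longrightarrow> keys h \<inter> F \<noteq> {}"
  proof (rule ccontr)
    assume "\<not> ?thesis"
    then obtain H where H: "\<forall>m\<in>keys f. keys (H m) \<subseteq> V \<and> m + H m \<in> A \<and> keys (H m) \<inter> F = {}"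
      by metis
    \<comment> \<open>The monomial with exponent \<open>K\<close> carries every monomial of
      \<open>f\<close> into the ideal while avoiding the variables in \<open>F\<close>.\<close>
    define K where "K = (\<Sum>m\<in>keys f. H m)"
    have keysK: "keys (\<Sum>m\<in>B. H m) = (\<Union>m\<in>B. keys (H m))" if "finite B" for B
      using that by (induction B rule: finite_induct) (auto simp: keys_add_nat)
    have "m + K \<in> A" if m: "m \<in> keys f" for m
    proof -
      have "m + K = (\<Sum>l\<in>keys f - {m}. H l) + (m + H m)"
        using m by (simp add: K_def sum.remove[of _ m] ac_simps)
      then show ?thesis using A H m by (simp add: upclosed_def)
    qed
    moreover have "keys K \<subseteq> V" "keys K \<inter> F = {}" using H by (auto simp: K_def keysK)
    ultimately show False using colon monF by blast
  qed
  then obtain m where m: "m \<in> keys f" "\<And>h. keys h \<subseteq> V \<Longrightarrow> m + h \<in> A \<Longrightarrow> keys h \<inter> F \<noteq> {}"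
    by blast
  show thesis
  proof (rule that)
    show "F \<subseteq> V" by (auto simp: F_def)
    show "P = prime_of V F" by (rule PF)
    show "keys m \<subseteq> V" using m(1) f by auto
    show "m + h \<in> A \<longleftrightarrow> keys h \<inter> F \<noteq> {}" if "keys h \<subseteq> V" for h
      using m colon[OF that] monF[OF that] that by blast
  qed
qed


section \<open>Powers of edge ideals\<close>

definition edge_power :: "'a set set \<Rightarrow> nat \<Rightarrow> ('a \<Rightarrow>\<^sub>0 nat) set" where
  "edge_power E t = {m. \<exists>M. packing E (lookup m) M \<and> size M = t}"

lemma packing_mono: "packing E m M \<Longrightarrow> (\<And>x. m x \<le> m' x) \<Longrightarrow> packing E m' M"
  unfolding packing_def by (meson le_trans)

lemma upclosed_edge_power: "upclosed (edge_power E t)"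
  unfolding upclosed_def edge_power_def
  by (auto simp: lookup_add elim!: packing_mono intro!: exI)

lemma edge_ideal_conv:
  fixes G :: "('a, 'b) pre_digraph"
  assumes E: "simple_edges (edges G)" and V: "\<Union> (edges G) \<subseteq> verts G"
  shows "(edge_ideal G :: (('a \<Rightarrow>\<^sub>0 nat) \<Rightarrow>\<^sub>0 'k::field) set) =
    mono_span (verts G) (edge_power (edges G) 1)"
proof
  let ?R = "mpoly_ring (verts G) :: (('a \<Rightarrow>\<^sub>0 nat) \<Rightarrow>\<^sub>0 'k) ring"
  let ?S = "{var i * var j | i j. {i, j} \<in> edges G} :: (('a \<Rightarrow>\<^sub>0 nat) \<Rightarrow>\<^sub>0 'k) set"
  interpret cring ?R by (rule cring_mpoly_ring)
  have vv: "var i * var j = single (single i 1 + single j 1) (1::'k)" for i j :: 'a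
    by (simp add: var_def mult_single)
  have ijV: "i \<in> verts G" "j \<in> verts G" if "{i, j} \<in> edges G" for i j
    using V that by blast+
  have S: "?S \<subseteq> carrier ?R"
    using ijV by (auto simp: vv keys_add_nat)
  show "edge_ideal G \<subseteq> (mono_span (verts G) (edge_power (edges G) 1) :: (('a \<Rightarrow>\<^sub>0 nat) \<Rightarrow>\<^sub>0 'k) set)"
    unfolding edge_ideal_def
  proof (rule genideal_minimal[OF ideal_mono_span[OF upclosed_edge_power]], rule subsetI)
    fix p assume "p \<in> ?S"
    then obtain i j where p: "p = var i * var j" "{i, j} \<in> edges G" by blast
    have "i \<noteq> j" using E p(2) unfolding simple_edges_def by fastforce
    then have "packing (edges G) (lookup (single i 1 + single j 1)) {#{i, j}#}"
      using p(2) by (auto simp: packing_def lookup_add lookup_single when_def)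
    then have "single i 1 + single j 1 \<in> edge_power (edges G) 1"
      unfolding edge_power_def by (intro CollectI exI[of _ "{#{i, j}#}"]) simp
    then show "p \<in> mono_span (verts G) (edge_power (edges G) 1)"
      using p ijV by (auto simp: mono_span_def vv keys_add_nat)
  qed
  have id: "ideal (edge_ideal G) ?R"
    unfolding edge_ideal_def by (rule genideal_ideal[OF S])
  show "mono_span (verts G) (edge_power (edges G) 1) \<subseteq> (edge_ideal G :: (('a \<Rightarrow>\<^sub>0 nat) \<Rightarrow>\<^sub>0 'k) set)"
  proof (rule mono_span_subset_ideal[OF id])
    fix m :: "'a \<Rightarrow>\<^sub>0 nat" assume m: "m \<in> edge_power (edges G) 1" "keys m \<subseteq> verts G"
    then obtain M where M: "packing (edges G) (lookup m) M" "size M = 1"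
      unfolding edge_power_def by blast
    then obtain e where Me: "M = {#e#}" by (metis size_1_singleton_mset)
    have eE: "e \<in> edges G" using M(1) Me by (auto simp: packing_def)
    then obtain i j where ij: "e = {i, j}" "i \<noteq> j"
      using E unfolding simple_edges_def by blast
    have le: "of_bool (x \<in> {i, j}) \<le> lookup m x" for x
      using M(1) Me ij by (simp add: packing_def)
    \<comment> \<open>\<open>b\<close> is the exponent of the quotient by the generator of the edge
      \<open>e\<close>.\<close>
    define b where "b = m - (single i 1 + single j 1)"
    have "m = b + (single i 1 + single j 1)"
    proof (rule poly_mapping_eqI)
      show "lookup m x = lookup (b + (single i 1 + single j 1)) x" for x
        using le[of x] ij(2) by (auto simp: b_def lookup_add lookup_minus lookup_single when_def)
    qed
    then have "single m 1 = single b 1 * (var i * var j :: ('a \<Rightarrow>\<^sub>0 nat) \<Rightarrow>\<^sub>0 'k)" "keys b \<subseteq> keys m"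
      by (auto simp: vv mult_single keys_add_nat)
    moreover have "var i * var j \<in> (edge_ideal G :: (('a \<Rightarrow>\<^sub>0 nat) \<Rightarrow>\<^sub>0 'k) set)"
      unfolding edge_ideal_def using genideal_self[OF S] eE ij by blast
    ultimately show "single m 1 \<in> (edge_ideal G :: (('a \<Rightarrow>\<^sub>0 nat) \<Rightarrow>\<^sub>0 'k) set)"
      using ideal_mpoly_ringD(3)[OF id, of "single b 1" "var i * var j"] m(2) by auto
  qed
qed

text \<open>Multiplying monomials joins packings; conversely, a packing of size \<open>Suc t\<close>
  is one edge together with a packing of size \<open>t\<close>.\<close>

lemma edge_ideal_power:
  fixes G :: "('a, 'b) pre_digraph"
  assumes E: "simple_edges (edges G)" and V: "\<Union> (edges G) \<subseteq> verts G"
  defines "R \<equiv> mpoly_ring (verts G) :: (('a \<Rightarrow>\<^sub>0 nat) \<Rightarrow>\<^sub>0 'k::field) ring"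
  shows "edge_ideal G [^]\<^bsub>ideals_set R\<^esub> (t::nat) = mono_span (verts G) (edge_power (edges G) t)"
proof (induction t)
  case 0
  \<comment> \<open>The empty packing fits every weight, in accordance with the zeroth power being
    the whole ring.\<close>
  have "edge_power (edges G) 0 = UNIV"
    by (auto simp: edge_power_def packing_def)
  then show ?case
    by (simp add: nat_pow_def ideals_set_def R_def mono_span_def)
next
  case (Suc t)
  interpret cring R unfolding R_def by (rule cring_mpoly_ring)
  let ?J = "\<lambda>t. mono_span (verts G) (edge_power (edges G) t) :: (('a \<Rightarrow>\<^sub>0 nat) \<Rightarrow>\<^sub>0 'k) set"
  have id: "ideal (?J t) R" for t
    unfolding R_def by (rule ideal_mono_span[OF upclosed_edge_power])
  have "edge_ideal G [^]\<^bsub>ideals_set R\<^esub> Suc t = ideal_prod R (?J t) (?J 1)"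
    using Suc by (simp add: nat_pow_def ideals_set_def edge_ideal_conv[OF E V])
  also have "\<dots> = ?J (Suc t)"
  proof
    show "ideal_prod R (?J t) (?J 1) \<subseteq> ?J (Suc t)"
    proof
      fix p assume "p \<in> ideal_prod R (?J t) (?J 1)"
      then show "p \<in> ?J (Suc t)"
      proof (induction rule: ideal_prod.induct)
        case (prod i j)
        show ?case
          unfolding mono_span_def
        proof (intro CollectI ballI)
          fix m assume "m \<in> keys (i \<otimes>\<^bsub>R\<^esub> j)"
          then have "m \<in> keys (i * j)" by (simp add: R_def)
          then obtain a b where m: "m = a + b" "a \<in> keys i" "b \<in> keys j"
            using keys_mult[of i j] by blast
          then have "a \<in> edge_power (edges G) t" "b \<in> edge_power (edges G) 1"
            using prod by (auto simp: mono_span_def)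
          then obtain M N where "packing (edges G) (lookup a) M" "size M = t"
            "packing (edges G) (lookup b) N" "size N = 1"
            unfolding edge_power_def by blast
          then have "packing (edges G) (lookup m) (M + N)" "size (M + N) = Suc t"
            by (auto simp: packing_def m(1) lookup_add add_mono)
          then have "m \<in> edge_power (edges G) (Suc t)"
            unfolding edge_power_def by blast
          moreover have "keys m \<subseteq> verts G"
            using m prod by (auto simp: mono_span_def keys_add_nat)
          ultimately show "keys m \<subseteq> verts G \<and> m \<in> edge_power (edges G) (Suc t)" by blast
        qed
      next
        case (sum s1 s2)
        then show ?case
          using ideal_mpoly_ringD(2)[OF id[unfolded R_def]] by (simp add: R_def)
      qed
    qed
    have idp: "ideal (ideal_prod R (?J t) (?J 1)) (mpoly_ring (verts G))"
      using ideal_prod_is_ideal[OF id id] by (simp add: R_def)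
    show "?J (Suc t) \<subseteq> ideal_prod R (?J t) (?J 1)"
    proof (rule mono_span_subset_ideal[OF idp])
      fix m :: "'a \<Rightarrow>\<^sub>0 nat"
      assume m: "m \<in> edge_power (edges G) (Suc t)" "keys m \<subseteq> verts G"
      then obtain M where M: "packing (edges G) (lookup m) M" "size M = Suc t"
        unfolding edge_power_def by blast
      then obtain e N where MN: "M = add_mset e N" "size N = t" 
        by (metis size_eq_Suc_imp_eq_union nat.inject size_add_mset)
      have eE: "e \<in> edges G" using M(1) MN by (auto simp: packing_def)
      then obtain i j where ij: "e = {i, j}" "i \<noteq> j"
        using E unfolding simple_edges_def by blast
      have le: "edge_deg N x + of_bool (x \<in> {i, j}) \<le> lookup m x" for x
        using M(1) MN ij by (simp add: packing_def)
      \<comment> \<open>\<open>c\<close> is the exponent of the edge \<open>e\<close>, and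
        \<open>b\<close> is what remains of \<open>m\<close>, still enough for
        \<open>N\<close>.\<close>
      define c where "c = single i 1 + single j (1::nat)"
      define b where "b = m - c"
      have c: "lookup c x = of_bool (x \<in> {i, j})" for x
        using ij(2) by (auto simp: c_def lookup_add lookup_single when_def)
      have mbc: "m = b + c"
      proof (rule poly_mapping_eqI)
        show "lookup m x = lookup (b + c) x" for x
          using le[of x] by (simp add: b_def lookup_add lookup_minus c)
      qed
      have "packing (edges G) (lookup b) N"
        unfolding packing_def
      proof (intro conjI allI)
        show "edge_deg N x \<le> lookup b x" for x
          using le[of x] by (simp add: b_def lookup_minus c)
      qed (use M(1) MN in \<open>simp add: packing_def\<close>)
      then have "b \<in> edge_power (edges G) t" unfolding edge_power_def using MN(2) by blast
      moreover have "packing (edges G) (lookup c) {#e#}"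
        using eE ij by (simp add: packing_def c)
      then have "c \<in> edge_power (edges G) 1"
        unfolding edge_power_def by (intro CollectI exI[of _ "{#e#}"]) simp
      ultimately have "single b 1 \<in> ?J t" "single c 1 \<in> ?J 1"
        using m(2) by (auto simp: mono_span_def mbc keys_add_nat)
      from ideal_prod.prod[OF this, of R] show "single m 1 \<in> ideal_prod R (?J t) (?J 1)"
        by (simp add: R_def mult_single mbc)
    qed
  qed
  finally show ?case .
qed

text \<open>A monomial involving a variable of \<open>F\<close> is a multiple of that variable, and
  packings survive larger weights, so on the side of \<open>F\<close> single variables
  suffice.\<close>

lemma colon_witness_iff:
  assumes V: "finite V" and F: "F \<subseteq> V"
  shows "(\<forall>h. keys h \<subseteq> V \<longrightarrow> (m + h \<in> edge_power E t \<longleftrightarrow> keys h \<inter> F \<noteq> {})) \<longleftrightarrow>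
    colon_witness E V F t (lookup m)"
proof
  assume L: "\<forall>h. keys h \<subseteq> V \<longrightarrow> (m + h \<in> edge_power E t \<longleftrightarrow> keys h \<inter> F \<noteq> {})"
  show "colon_witness E V F t (lookup m)"
    unfolding colon_witness_def
  proof (intro conjI ballI allI impI)
    fix i assume "i \<in> F"
    then have "m + single i 1 \<in> edge_power E t" using L F by auto
    moreover have "lookup (m + single i 1) = (\<lambda>x. lookup m x + of_bool (x = i))"
      by (auto simp: lookup_add lookup_single when_def)
    ultimately show "\<exists>M. packing E (\<lambda>x. lookup m x + of_bool (x = i)) M \<and> size M = t"
      by (simp add: edge_power_def)
  next
    fix h :: "'a \<Rightarrow> nat" assume h: "\<forall>x. h x \<noteq> 0 \<longrightarrow> x \<in> V - F"
    then have "finite {x. h x \<noteq> 0}" by (intro finite_subset[OF _ V]) auto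
    then have lh: "lookup (Abs_poly_mapping h) = h" by simp
    then have "keys (Abs_poly_mapping h) \<subseteq> V - F" using h by (auto simp: in_keys_iff)
    then have "m + Abs_poly_mapping h \<notin> edge_power E t" using L by blast
    moreover have "lookup (m + Abs_poly_mapping h) = (\<lambda>x. lookup m x + h x)"
      by (auto simp: lookup_add lh)
    ultimately show "\<nexists>M. packing E (\<lambda>x. lookup m x + h x) M \<and> size M = t"
      by (simp add: edge_power_def)
  qed
next
  assume C: "colon_witness E V F t (lookup m)"
  show "\<forall>h. keys h \<subseteq> V \<longrightarrow> (m + h \<in> edge_power E t \<longleftrightarrow> keys h \<inter> F \<noteq> {})"
  proof (intro allI impI)
    fix h :: "'a \<Rightarrow>\<^sub>0 nat" assume h: "keys h \<subseteq> V"
    have lh: "lookup (m + h) = (\<lambda>x. lookup m x + lookup h x)"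
      by (auto simp: lookup_add)
    show "m + h \<in> edge_power E t \<longleftrightarrow> keys h \<inter> F \<noteq> {}"
    proof (cases "keys h \<inter> F = {}")
      case True
      then have "\<forall>x. lookup h x \<noteq> 0 \<longrightarrow> x \<in> V - F" using h by (auto simp: in_keys_iff)
      then have "\<nexists>M. packing E (lookup (m + h)) M \<and> size M = t"
        using C unfolding colon_witness_def lh by blast
      then show ?thesis using True unfolding edge_power_def by blast
    next
      case False
      then obtain i where i: "i \<in> F" "lookup h i > 0" by (auto simp: in_keys_iff)
      then obtain M where M: "packing E (\<lambda>x. lookup m x + of_bool (x = i)) M" "size M = t"
        using C unfolding colon_witness_def by blast
      have "packing E (lookup (m + h)) M"
        by (rule packing_mono[OF M(1)]) (use i in \<open>auto simp: lookup_add\<close>)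
      then show ?thesis using False M(2) unfolding edge_power_def by blast
    qed
  qed
qed

text \<open>Associated primes of a monomial ideal are generated by variables and have monomial
  witnesses, which leaves a question about packings alone.\<close>

lemma Ass_edge_ideal_power:
  fixes G :: "('a::linorder, 'b) pre_digraph"
  assumes E: "simple_edges (edges G)" and V: "\<Union> (edges G) \<subseteq> verts G" "finite (verts G)"
  defines "R \<equiv> mpoly_ring (verts G) :: (('a \<Rightarrow>\<^sub>0 nat) \<Rightarrow>\<^sub>0 'k::field) ring"
  shows "Ass R (edge_ideal G [^]\<^bsub>ideals_set R\<^esub> (t::nat)) = {prime_of (verts G) F | F. F \<subseteq> verts G \<and>
    (\<exists>m. (\<forall>x. x \<notin> verts G \<longrightarrow> m x = 0) \<and> colon_witness (edges G) (verts G) F t m)}"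
proof -
  let ?A = "edge_power (edges G) t"
  have eq: "edge_ideal G [^]\<^bsub>ideals_set R\<^esub> (t::nat) = mono_span (verts G) ?A"
    unfolding R_def by (rule edge_ideal_power[OF E V(1)])
  show ?thesis
    unfolding eq
  proof (intro equalityI subsetI)
    fix P assume "P \<in> Ass R (mono_span (verts G) ?A)"
    then obtain F m where F: "F \<subseteq> verts G" "P = prime_of (verts G) F" "keys m \<subseteq> verts G"
      "\<And>h. keys h \<subseteq> verts G \<Longrightarrow> m + h \<in> ?A \<longleftrightarrow> keys h \<inter> F \<noteq> {}"
      unfolding R_def by (rule Ass_mono_spanE[OF upclosed_edge_power]) metis
    then have "colon_witness (edges G) (verts G) F t (lookup m)"
      using colon_witness_iff[OF V(2) F(1)] by blast
    moreover have "\<forall>x. x \<notin> verts G \<longrightarrow> lookup m x = 0"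
      using F(3) by (auto simp: in_keys_iff)
    ultimately show "P \<in> {prime_of (verts G) F | F. F \<subseteq> verts G \<and>
      (\<exists>m. (\<forall>x. x \<notin> verts G \<longrightarrow> m x = 0) \<and> colon_witness (edges G) (verts G) F t m)}"
      using F(1,2) by blast
  next
    fix P :: "(('a \<Rightarrow>\<^sub>0 nat) \<Rightarrow>\<^sub>0 'k) set" assume "P \<in> {prime_of (verts G) F | F. F \<subseteq> verts G \<and>
      (\<exists>m. (\<forall>x. x \<notin> verts G \<longrightarrow> m x = 0) \<and> colon_witness (edges G) (verts G) F t m)}"
    then obtain F m where F: "P = prime_of (verts G) F" "F \<subseteq> verts G"
      and m: "\<forall>x. x \<notin> verts G \<longrightarrow> m x = 0" and wit: "colon_witness (edges G) (verts G) F t m"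
      by blast
    have "finite {x. m x \<noteq> 0}" using m by (intro finite_subset[OF _ V(2)]) auto
    then have lm: "lookup (Abs_poly_mapping m) = m" by simp
    then have "keys (Abs_poly_mapping m) \<subseteq> verts G" using m by (auto simp: in_keys_iff)
    then show "P \<in> Ass R (mono_span (verts G) ?A)"
      unfolding F(1) R_def
      using colon_witness_iff[OF V(2) F(2), of "Abs_poly_mapping m" "edges G" t] wit
      by (intro prime_of_in_Ass[of "Abs_poly_mapping m"]) (auto simp: lm)
  qed
qed


section \<open>Odd cycles and saturating subgraphs\<close>

lemma critical_mono: "critical E f k C \<Longrightarrow> E \<subseteq> E' \<Longrightarrow> critical E' f k C"
  unfolding critical_def by (meson order_trans)

context wf_digraph
begin

text \<open>At a repeated vertex a closed walk splits into two shorter closed walks, one of which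
  has odd length.\<close>

lemma odd_cycle_of_odd_closed_awalk:
  assumes "awalk u p u" "odd (length p)"
  shows "\<exists>p. cycle p \<and> odd (length p)"
  using assms
proof (induction "length p" arbitrary: u p rule: less_induct)
  case less
  show ?case
  proof (cases "distinct (tl (awalk_verts u p))")
    case True
    moreover have "p \<noteq> []" using less.prems(2) by auto
    ultimately show ?thesis using less.prems unfolding cycle_def by blast
  next
    case False
    \<comment> \<open>A cycle must have distinct vertices only after the first entry, so the first
      arc is set aside before a repetition is sought.\<close>
    obtain e es where p: "p = e # es" using less.prems(2) by (cases p) auto
    have es: "awalk (head G e) es u" "\<not> distinct (awalk_verts (head G e) es)"
      using less.prems(1) False p by (auto simp: awalk_Cons_iff)
    obtain q r s w where qrs: "es = q @ r @ s" "length r > 0" "awalk (head G e) q w"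
      "awalk w r w" "awalk w s u"
      using awalk_not_distinct_decomp[OF es] by blast
    show ?thesis
    proof (cases "odd (length r)")
      case True
      then show ?thesis using less.hyps[of r w] qrs p by simp
    next
      case False
      have "awalk u (e # q @ s) u"
        using less.prems(1) p qrs by (auto simp: awalk_Cons_iff)
      moreover have "odd (length (e # q @ s))"
        using less.prems(2) p qrs(1) False by simp
      moreover have "length (e # q @ s) < length p" using p qrs by simp
      ultimately show ?thesis using less.hyps by blast
    qed
  qed
qed

lemma awalk_of_relpow:
  assumes "(u, v) \<in> arcs_ends G ^^ n" "u \<in> verts G"
  shows "\<exists>p. awalk u p v \<and> length p = n"
  using assms
proof (induction n arbitrary: u)
  case 0
  then show ?case by (intro exI[of _ "[]"]) (auto simp: awalk_Nil_iff)
next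
  case (Suc n)
  then obtain w where w: "(u, w) \<in> arcs_ends G" "(w, v) \<in> arcs_ends G ^^ n"
    by (metis relpow_Suc_E2)
  then obtain e where e: "e \<in> arcs G" "tail G e = u" "head G e = w" by auto
  then obtain p where "awalk w p v" "length p = n" using Suc.IH[OF w(2)] by auto
  then show ?case using e by (intro exI[of _ "e # p"]) (auto simp: awalk_Cons_iff)
qed

lemma cas_nth:
  assumes "cas u p v" "q < length p"
  shows "awalk_verts u p ! q = tail G (p ! q) \<and> awalk_verts u p ! Suc q = head G (p ! q)"
  using assms
proof (induction p arbitrary: u q)
  case (Cons e p)
  then show ?case
    by (cases q; cases p) auto
qed simp

end

context graph
begin

lemma simple_edges_edges: "simple_edges (edges G)"
  unfolding simple_edges_def
proof
  fix e assume "e \<in> edges G"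
  then obtain u v where uv: "e = {u, v}" "u \<rightarrow> v" by (auto simp: edges_def)
  then have "u \<noteq> v" using adj_not_same by auto
  with uv show "\<exists>u v. u \<noteq> v \<and> e = {u, v}" by blast
qed

lemma edges_iff_dominates: "{u, v} \<in> edges G \<longleftrightarrow> u \<rightarrow> v"
  using graph_symmetric by (auto simp: edges_def doubleton_eq_iff)

lemma adj_edges: "adj (edges G) = arcs_ends G"
  by (auto simp: adj_def edges_iff_dominates)

lemma Union_edges: "\<Union> (edges G) \<subseteq> verts G"
  using adj_in_verts by (auto simp: edges_def)

lemma finite_edges: "finite (edges G)"
  by (rule finite_subset[of _ "Pow (verts G)"]) (use Union_edges in auto)

lemma graph_induced:
  assumes "induced_subgraph H G"
  shows "graph H"
proof -
  have "subgraph H G" using assms by blast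
  then have "digraph H" "fin_digraph H"
    by (rule digraph_subgraph, rule fin_digraph_subgraph)
  moreover have "sym_digraph H" by (rule induced_graph_imp_graph[OF assms])
  ultimately show ?thesis
    by (simp add: graph_def pseudo_graph_def)
qed

lemma edges_induced:
  assumes "induced_subgraph H G"
  shows "edges H = {e \<in> edges G. e \<subseteq> verts H}"
proof -
  have c: "compatible G H" and a: "arcs H = {e \<in> arcs G. tail G e \<in> verts H \<and> head G e \<in> verts H}"
    using assms by auto
  have "u \<rightarrow>\<^bsub>H\<^esub> v \<longleftrightarrow> u \<rightarrow> v \<and> u \<in> verts H \<and> v \<in> verts H" for u v
    using c by (auto simp: arcs_ends_conv a compatible_tail compatible_head image_iff)
  then have dom: "u \<rightarrow>\<^bsub>H\<^esub> v \<longleftrightarrow> u \<rightarrow> v \<and> {u, v} \<subseteq> verts H" for u v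
    by simp
  show ?thesis
    unfolding edges_def dom by blast
qed

text \<open>Every step of a walk changes the side of the bipartition.\<close>

lemma bipartite_no_odd_closed_walk:
  assumes "bipartite G" "(j, j) \<in> adj (edges G) ^^ n"
  shows "even n"
proof -
  obtain A B where AB: "A \<inter> B = {}" "\<And>e. e \<in> edges G \<Longrightarrow> \<exists>a\<in>A. \<exists>b\<in>B. e = {a, b}"
    using assms(1) unfolding bipartite_def by metis
  have step: "(v \<in> A) \<noteq> (u \<in> A)" if "(u, v) \<in> adj (edges G)" for u v
  proof -
    have "{u, v} \<in> edges G" using that by (simp add: adj_def)
    from AB(2)[OF this] obtain a b where "a \<in> A" "b \<in> B" "{u, v} = {a, b}" by blast
    then show ?thesis using AB(1) by (auto simp: doubleton_eq_iff)
  qed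
  have "(v \<in> A) = ((u \<in> A) = even n)" if "(u, v) \<in> adj (edges G) ^^ n" for u v n
    using that
  proof (induction n arbitrary: v)
    case (Suc n)
    then obtain w where "(u, w) \<in> adj (edges G) ^^ n" "(w, v) \<in> adj (edges G)" by auto
    then show ?case using Suc.IH step by auto
  qed simp
  from this[OF assms(2)] show ?thesis by blast
qed

text \<open>Presents the cycle as a function on positions, the form used for critical weights;
  \<open>r > 0\<close> because there are no loops.\<close>

lemma has_odd_cycleE:
  assumes "has_odd_cycle G"
  obtains r P where "\<And>q. q < 2 * r + 1 \<Longrightarrow> {P q, P (Suc q)} \<in> edges G" "P (2 * r + 1) = P 0"
    "inj_on P {..<2 * r + 1}" "P ` {..<2 * r + 1} \<subseteq> verts G" "r > 0"
proof -
  obtain u p where p: "awalk u p u" "distinct (tl (awalk_verts u p))" "odd (length p)"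
    using assms unfolding has_odd_cycle_def cycle_def by blast
  then obtain r where r: "length p = 2 * r + 1" by (auto elim: oddE)
  define P where "P q = awalk_verts u p ! q" for q
  have len: "length (awalk_verts u p) = Suc (length p)" by (rule length_awalk_verts)
  have ne: "awalk_verts u p \<noteq> []" by simp
  have P0: "P 0 = u" and PN: "P (2 * r + 1) = u"
    using p(1) len r ne by (auto simp: P_def awalk_conv hd_conv_nth last_conv_nth)
  have e: "{P q, P (Suc q)} \<in> edges G" if "q < 2 * r + 1" for q
  proof -
    have "p ! q \<in> arcs G" using p(1) that r by (metis awalkE nth_mem subsetD)
    then have "tail G (p ! q) \<rightarrow> head G (p ! q)" by (rule in_arcs_imp_in_arcs_ends)
    moreover have "cas u p u" using p(1) by blast
    ultimately show ?thesis
      using cas_nth[of u p u q] that r by (simp add: edges_iff_dominates P_def)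
  qed
  have "inj_on P {1..<2 * r + 2}"
  proof (rule inj_onI)
    fix x y assume xy: "x \<in> {1..<2 * r + 2}" "y \<in> {1..<2 * r + 2}" "P x = P y"
    have "tl (awalk_verts u p) ! (z - 1) = P z" if "z \<in> {1..<2 * r + 2}" for z
      using that len r by (cases z) (simp_all add: P_def nth_tl)
    then have "tl (awalk_verts u p) ! (x - 1) = tl (awalk_verts u p) ! (y - 1)"
      using xy by simp
    moreover have "x - 1 < length (tl (awalk_verts u p))" "y - 1 < length (tl (awalk_verts u p))"
      using xy len r by auto
    ultimately have "x - 1 = y - 1" using p(2) by (metis nth_eq_iff_index_eq)
    then show "x = y" using xy by auto
  qed
  then have inj: "x = y" if "P x = P y" "x \<ge> 1" "y \<ge> 1" "x \<le> 2 * r + 1" "y \<le> 2 * r + 1" for x y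
    using that by (auto dest: inj_onD)
  have "inj_on P {..<2 * r + 1}"
  proof (rule inj_onI)
    fix x y assume xy: "x \<in> {..<2 * r + 1}" "y \<in> {..<2 * r + 1}" "P x = P y"
    \<comment> \<open>Distinctness is known for positions 1 to \<open>2r + 1\<close>;
      \<open>s\<close> moves position 0 to the last one, which carries the same vertex.\<close>
    define s where "s z = (if z = 0 then 2 * r + 1 else z)" for z
    have "P (s z) = P z" for z using P0 PN by (simp add: s_def)
    then have "s x = s y" using xy by (intro inj) (auto simp: s_def)
    then show "x = y" using xy by (auto simp: s_def split: if_splits)
  qed
  moreover have "P q \<in> verts G" if "q < 2 * r + 1" for q
    using e[OF that] Union_edges by blast
  then have "P ` {..<2 * r + 1} \<subseteq> verts G" by blast
  moreover have "r > 0"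
  proof (rule ccontr)
    assume "\<not> r > 0"
    then have "{u, u} \<in> edges G" using e[of 0] P0 PN by simp
    then show False using edges_iff_dominates adj_not_same by blast
  qed
  moreover have "P (2 * r + 1) = P 0" using P0 PN by simp
  ultimately show thesis using e that[of r P] by blast
qed

lemma has_odd_cycle_odd_closed_walk:
  assumes "has_odd_cycle G"
  shows "\<exists>j n. (j, j) \<in> adj (edges G) ^^ (2 * n + 1)"
proof -
  obtain r P where P: "\<And>q. q < 2 * r + 1 \<Longrightarrow> {P q, P (Suc q)} \<in> edges G" "P (2 * r + 1) = P 0"
    using has_odd_cycleE[OF assms] by metis
  have "(P 0, P q) \<in> adj (edges G) ^^ q" if "q \<le> 2 * r + 1" for q
    using that
  proof (induction q)
    case (Suc q)
    then have "(P q, P (Suc q)) \<in> adj (edges G)" using P(1)[of q] by (simp add: adj_def)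
    then show ?case using Suc by (auto intro: relcompI)
  qed simp
  from this[of "2 * r + 1"] P(2) show ?thesis by (metis order_refl)
qed

section \<open>Strongly saturating subgraphs and critical weights\<close>

lemma matching_obtains:
  assumes "k \<le> matching_number G"
  obtains M where "M \<subseteq> edges G" "disjoint M" "k \<le> card M"
proof -
  let ?S = "{M. M \<subseteq> edges G \<and> disjoint M}"
  have "finite ?S" by (rule finite_subset[of _ "Pow (edges G)"]) (use finite_edges in auto)
  moreover have "{} \<in> ?S" by simp
  ultimately have "matching_number G \<in> card ` ?S"
    unfolding matching_number_def by (intro Max_in) auto
  then show thesis using assms that by auto
qed

lemma graph_del_vert: "graph (del_vert v)"
proof -
  have "induced_subgraph (del_vert v) G"
  proof (rule induced_subgraphI)
    show "subgraph (del_vert v) G" by (rule subgraph_del_vert)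
    show "arcs (del_vert v) = {e \<in> arcs G. tail G e \<in> verts (del_vert v) \<and> head G e \<in> verts (del_vert v)}"
      by (auto simp: del_vert_def)
  qed
  then show ?thesis by (rule graph_induced)
qed

text \<open>After the deletion of \<open>c\<close> there remain \<open>2s - 2\<close> vertices, so a
  matching with \<open>s - 1\<close> edges is perfect: the graph is factor-critical.\<close>

lemma critical_strongly_saturating:
  assumes sat: "strongly_saturating s G" and card: "card (verts G) = 2 * s - 1"
  shows "critical (edges G) (\<lambda>x. of_bool (x \<in> verts G)) (s - 1) (verts G)"
  unfolding critical_def
proof (intro conjI allI impI ballI)
  fix c assume c: "c \<in> verts G"
  interpret D: graph "del_vert c" by (rule graph_del_vert)
  have "s - 1 \<le> matching_number (del_vert c)"
    using sat c by (simp add: strongly_saturating_def)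
  then obtain M where M: "M \<subseteq> edges (del_vert c)" "disjoint M" "s - 1 \<le> card M"
    by (rule D.matching_obtains)
  have finM: "finite M" using M(1) D.finite_edges finite_subset by blast
  have sub: "e \<subseteq> verts G - {c}" if "e \<in> M" for e
    using that M(1) D.Union_edges by (auto simp: del_vert_def)
  let ?N = "mset_set M"
  have "(\<Sum>x\<in>verts G - {c}. edge_deg ?N x) = 2 * size ?N"
    by (rule handshake[OF D.simple_edges_edges]) (use M(1) finM sub in auto)
  then have sum: "(\<Sum>x\<in>verts G - {c}. edge_deg ?N x) = 2 * card M" by simp
  have deg: "edge_deg ?N x \<le> 1" for x
  proof -
    have "edge_deg ?N x = card {e \<in> M. x \<in> e}"
      using finM by (simp add: edge_deg_def filter_mset_mset_set)
    also have "\<dots> \<le> 1"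
    proof -
      have "e = e'" if "e \<in> M" "x \<in> e" "e' \<in> M" "x \<in> e'" for e e'
        using M(2) that unfolding disjoint_def by blast
      then show ?thesis using finM by (simp add: card_le_Suc0_iff_eq)
    qed
    finally show ?thesis .
  qed
  have cardc: "card (verts G - {c}) = 2 * (s - 1)" using card c by (simp add: card_Diff_singleton)
  have le: "(\<Sum>x\<in>verts G - {c}. edge_deg ?N x) \<le> (\<Sum>x\<in>verts G - {c}. 1)"
    by (rule sum_mono) (rule deg)
  then have "2 * card M \<le> 2 * (s - 1)" using sum cardc by simp
  then have size: "card M = s - 1" using M(3) by simp
  have one: "edge_deg ?N x = 1" if x: "x \<in> verts G - {c}" for x
  proof (rule ccontr)
    assume "edge_deg ?N x \<noteq> 1"
    then have "edge_deg ?N x < 1" using deg[of x] by simp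
    then have "(\<Sum>x\<in>verts G - {c}. edge_deg ?N x) < (\<Sum>x\<in>verts G - {c}. 1)"
      using x deg by (intro sum_strict_mono_ex1) auto
    then show False using sum size cardc by simp
  qed
  have zero: "edge_deg ?N x = 0" if "x \<notin> verts G - {c}" for x
  proof -
    have "\<not> edge_deg ?N x > 0"
      using sub that finM by (auto simp: edge_deg_pos_iff)
    then show ?thesis by simp
  qed
  show "\<exists>M. set_mset M \<subseteq> edges G \<and> size M = s - 1 \<and>
    (\<forall>x. edge_deg M x + of_bool (x = c) = of_bool (x \<in> verts G))"
  proof (intro exI[of _ ?N] conjI allI)
    have "edges (del_vert c) \<subseteq> edges G"
      by (auto simp: edges_def del_vert_def arcs_ends_conv)
    then show "set_mset ?N \<subseteq> edges G" using M(1) finM by auto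
    show "size ?N = s - 1" using size by simp
    show "edge_deg ?N x + of_bool (x = c) = of_bool (x \<in> verts G)" for x
      using one[of x] zero[of x] c by (cases "x = c"; cases "x \<in> verts G") auto
  qed
qed simp

text \<open>The maximum is attained: the number of vertices bounds the admissible values, and a
  single vertex provides the value 1.\<close>

lemma sat_number_obtains:
  assumes "verts G \<noteq> {}"
  obtains C where "graph C" "subgraph C G" "card (verts C) = 2 * sat_number G - 1"
    "strongly_saturating (sat_number G) C" "sat_number G \<ge> 1" "sat_number G \<le> card (verts G)"
proof -
  let ?S = "{s. \<exists>C. graph C \<and> subgraph C G \<and> card (verts C) = 2 * s - 1 \<and> strongly_saturating s C}"
  have ge: "s \<ge> 1" if "s \<in> ?S" for s
    using that unfolding strongly_saturating_def by auto
  have le: "s \<le> card (verts G)" if s: "s \<in> ?S" for s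
  proof -
    obtain C where "subgraph C G" "card (verts C) = 2 * s - 1" using s by blast
    then have "2 * s - 1 \<le> card (verts G)"
      by (metis card_mono finite_verts subgraph_imp_subverts)
    then show ?thesis using ge[OF s] by simp
  qed
  have fin: "finite ?S"
    by (rule finite_subset[of _ "{..card (verts G)}"]) (use le in auto)
  obtain v where v: "v \<in> verts G" using assms by blast
  let ?C = "\<lparr>verts = {v}, arcs = {}, tail = tail G, head = head G\<rparr>"
  have gC: "graph ?C"
    by unfold_locales (auto simp: symmetric_def arcs_ends_def sym_def)
  have sC: "subgraph ?C G"
    using v gC by (intro subgraphI) (auto simp: compatible_def graph_def digraph_def fin_digraph_def wf_digraph)
  have "matching_number ?C = 0"
    by (simp add: matching_number_def edges_def arcs_ends_def)
  then have "strongly_saturating 1 ?C" by (simp add: strongly_saturating_def)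
  then have "1 \<in> ?S" using gC sC by (intro CollectI exI[of _ ?C]) simp
  then have "sat_number G \<in> ?S"
    unfolding sat_number_def by (intro Max_in[OF fin]) blast
  then show thesis using that ge[of "sat_number G"] le[of "sat_number G"] by blast
qed

text \<open>Supplies the crossing edges along which critical weights grow over a component.\<close>

lemma strongly_connected_crossing_edge:
  assumes "strongly_connected G" "D \<subset> verts G" "D \<noteq> {}"
  shows "\<exists>p\<in>D. \<exists>v\<in>verts G - D. {p, v} \<in> edges G"
proof (rule ccontr)
  assume no: "\<not> ?thesis"
  obtain u w where uw: "u \<in> D" "w \<in> verts G" "w \<notin> D" using assms(2,3) by blast
  then have "u \<rightarrow>\<^sup>* w" using assms(1,2) by blast
  then have "w \<in> D"
  proof (induction rule: reachable_induct)
    case base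
    then show ?case using uw by simp
  next
    case (step x y)
    have "y \<in> verts G" using step(2) adj_in_verts by blast
    moreover have "{x, y} \<in> edges G" using step(2) by (simp add: edges_iff_dominates)
    ultimately show ?case using no step by blast
  qed
  with uw show False by blast
qed

text \<open>
  A single vertex is strongly 1-saturating but cannot be extended, as it has no neighbour of its own.
  Instead of showing that an odd cycle makes the saturation number at least 2, the proof uses the
  cycle itself when that number is 1.
\<close>
lemma critical_component:
  assumes conn: "strongly_connected G" and odd: "has_odd_cycle G"
    and K: "card (verts G) - sat_number G \<le> K"
  shows "\<exists>f. critical (edges G) f K (verts G)"
proof -
  have ne: "verts G \<noteq> {}" using conn by (simp add: strongly_connected_def)
  obtain C where C: "graph C" "subgraph C G" "card (verts C) = 2 * sat_number G - 1"
    "strongly_saturating (sat_number G) C" "sat_number G \<ge> 1"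
    using sat_number_obtains[OF ne] by metis
  show ?thesis
  proof (cases "sat_number G = 1")
    case False
    interpret C: graph C by (rule C(1))
    have sub: "verts C \<subseteq> verts G" using C(2) by (rule subgraph_imp_subverts)
    have "edges C \<subseteq> edges G"
      using C(2) arcs_ends_mono[OF C(2)] by (auto simp: edges_def)
    with C.critical_strongly_saturating[OF C(4,3)]
    have cr: "critical (edges G) (\<lambda>x. of_bool (x \<in> verts C)) (sat_number G - 1) (verts C)"
      by (rule critical_mono)
    have "card (verts G - verts C) = card (verts G) - card (verts C)"
      using sub by (intro card_Diff_subset) auto
    moreover have "card (verts C) \<le> card (verts G)" using sub by (intro card_mono) auto
    \<comment> \<open>With \<open>s\<close> the saturation number and \<open>n\<close> the number of
      vertices, \<open>(s - 1) + (n - (2s - 1)) = n - s\<close>.\<close>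
    ultimately have "sat_number G - 1 + card (verts G - verts C) \<le> K"
      using K C(3,5) by simp
    moreover have "2 \<le> card (verts C)" using C(3,5) False by simp
    ultimately show ?thesis
      using critical_grow[OF simple_edges_edges cr sub finite_verts _ strongly_connected_crossing_edge[OF conn]]
      by blast
  next
    case True
    obtain r P where P: "\<And>q. q < 2 * r + 1 \<Longrightarrow> {P q, P (Suc q)} \<in> edges G" "P (2 * r + 1) = P 0"
      "inj_on P {..<2 * r + 1}" "P ` {..<2 * r + 1} \<subseteq> verts G" "r > 0"
      using has_odd_cycleE[OF odd] by metis
    let ?C = "P ` {..<2 * r + 1}"
    have cr: "critical (edges G) (\<lambda>x. \<Sum>q<2 * r + 1. of_bool (x = P q)) r ?C"
      by (rule critical_odd_closed_walk[OF simple_edges_edges P(1,2)])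
    have card: "card ?C = 2 * r + 1" using P(3) by (simp add: card_image)
    have "card (verts G - ?C) = card (verts G) - card ?C"
      using P(4) by (intro card_Diff_subset) auto
    moreover have "card ?C \<le> card (verts G)" using P(4) by (intro card_mono) auto
    \<comment> \<open>On \<open>n\<close> vertices the cycle needs
      \<open>r + (n - (2r + 1)) = n - r - 1\<close> edges, within the bound
      \<open>n - 1\<close>.\<close>
    ultimately have "r + card (verts G - ?C) \<le> K"
      using K True card by simp
    moreover have "2 \<le> card ?C" using card P(5) by simp
    ultimately show ?thesis
      using critical_grow[OF simple_edges_edges cr P(4) finite_verts _ strongly_connected_crossing_edge[OF conn]]
      by blast
  qed
qed

end


section \<open>Stability of the associated primes\<close>

lemma relpow_mono: "R \<subseteq> S \<Longrightarrow> R ^^ n \<subseteq> S ^^ n" for R S :: "'a rel"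
  by (induction n) (auto intro: relcomp_mono)

context graph
begin

lemma graph_induce: "S \<subseteq> verts G \<Longrightarrow> graph (G \<restriction> S)"
  by (rule graph_induced[OF induced_induce])

lemma edges_induce: "S \<subseteq> verts G \<Longrightarrow> edges (G \<restriction> S) = {e \<in> edges G. e \<subseteq> S}"
  using edges_induced[OF induced_induce] by simp

lemma scc_in_sccs:
  assumes "H \<in> sccs"
  shows "induced_subgraph H G" "strongly_connected H" "verts H \<noteq> {}" "graph H"
    "edges H = {e \<in> edges G. e \<subseteq> verts H}" "G \<restriction> verts H = H"
proof -
  show "induced_subgraph H G" "strongly_connected H" using assms by auto
  then show "verts H \<noteq> {}" "graph H" "edges H = {e \<in> edges G. e \<subseteq> verts H}" "G \<restriction> verts H = H"
    by (auto simp: strongly_connected_def graph_induced edges_induced induce_eq_iff_induced)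
qed

lemma scc_closed_edge:
  assumes "H \<in> sccs" "i \<in> verts H" "{i, j} \<in> edges G"
  shows "j \<in> verts H"
proof -
  have "verts H \<in> sccs_verts" using assms(1) by (simp add: sccs_verts_conv)
  moreover have "i \<rightarrow> j" "j \<rightarrow> i"
    using assms(3) by (simp_all add: edges_iff_dominates[symmetric] insert_commute)
  then have "i \<rightarrow>\<^sup>* j" "j \<rightarrow>\<^sup>* i" by auto
  ultimately show ?thesis
    using assms(2) unfolding in_sccs_verts_conv_reachable by blast
qed

text \<open>A walk starting in a component never leaves it, so the closed walk runs in
  \<open>H\<close> and yields an odd cycle there.\<close>

lemma scc_odd_cycle:
  assumes H: "H \<in> sccs" and j: "j \<in> verts H" "(j, j) \<in> adj (edges G) ^^ (2 * n + 1)"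
  shows "has_odd_cycle H"
proof -
  interpret H: graph H by (rule scc_in_sccs[OF H])
  have "(v \<in> verts H) \<and> (j, v) \<in> adj (edges H) ^^ k" if "(j, v) \<in> adj (edges G) ^^ k" for v k
    using that
  proof (induction k arbitrary: v)
    case (Suc k)
    then obtain w where w: "(j, w) \<in> adj (edges G) ^^ k" "{w, v} \<in> edges G"
      by (auto simp: adj_def)
    then have IH: "w \<in> verts H" "(j, w) \<in> adj (edges H) ^^ k" using Suc.IH by auto
    moreover have "v \<in> verts H" by (rule scc_closed_edge[OF H IH(1) w(2)])
    ultimately have "(w, v) \<in> adj (edges H)"
      using w(2) scc_in_sccs(5)[OF H] by (simp add: adj_def)
    with IH \<open>v \<in> verts H\<close> show ?case by auto
  qed (use j in auto)
  from this[OF j(2)] have "(j, j) \<in> arcs_ends H ^^ (2 * n + 1)"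
    by (simp add: H.adj_edges)
  then obtain p where "H.awalk j p j" "length p = 2 * n + 1"
    using H.awalk_of_relpow j(1) by blast
  then show ?thesis
    using H.odd_cycle_of_odd_closed_awalk[of j p] by (simp add: has_odd_cycle_def)
qed

section \<open>Characterisation of the associated primes of high powers\<close>

text \<open>Any vertex of \<open>H\<close> has a neighbour on an odd closed walk inside the stable
  part, and this neighbour belongs to \<open>H\<close> too.\<close>

lemma odd_cycles_of_colon_witness:
  assumes F: "F \<subseteq> verts G" and wit: "colon_witness (edges G) (verts G) F t m"
    and H: "H \<in> pre_digraph.sccs (G \<restriction> stable_part (edges G) F)"
  shows "has_odd_cycle H"
proof -
  let ?S = "stable_part (edges G) F"
  have S: "?S \<subseteq> verts G" using F by (auto simp: stable_part_def)
  interpret S: graph "G \<restriction> ?S" by (rule graph_induce[OF S])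
  obtain i where i: "i \<in> verts H" using S.scc_in_sccs(3)[OF H] by blast
  then have "i \<in> ?S" using S.scc_in_sccs(1)[OF H] by (metis induce_subgraph_verts induced_imp_subgraph subgraph_imp_subverts subsetD)
  from colon_witness_odd_closed_walk[OF simple_edges_edges Union_edges
      finite_subset[OF F finite_verts] wit refl edges_induce[OF S] this]
  obtain j n where j: "{i, j} \<in> edges (G \<restriction> ?S)"
    "(j, j) \<in> adj (edges (G \<restriction> ?S)) ^^ (2 * n + 1)"
    by metis
  show ?thesis
    by (rule S.scc_odd_cycle[OF H S.scc_closed_edge[OF H i j(1)] j(2)])
qed

text \<open>A component \<open>C\<close> needs \<open>kk C\<close> edges, its number of vertices
  minus its saturation number. The sum of these numbers plus 1 is the value of
  \<open>s_subset\<close>, hence at most \<open>t\<close>.\<close>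

lemma colon_witness_of_odd_cycles:
  assumes F: "F \<subseteq> verts G" and cover: "\<And>e. e \<in> edges G \<Longrightarrow> e \<inter> F \<noteq> {}"
    and odd: "\<And>H. H \<in> pre_digraph.sccs (G \<restriction> stable_part (edges G) F) \<Longrightarrow> has_odd_cycle H"
    and t: "s_subset G (stable_part (edges G) F) \<le> int t"
  shows "\<exists>m. (\<forall>x. x \<notin> verts G \<longrightarrow> m x = 0) \<and> colon_witness (edges G) (verts G) F t m"
proof -
  let ?S = "stable_part (edges G) F"
  have S: "?S \<subseteq> verts G" using F by (auto simp: stable_part_def)
  interpret S: graph "G \<restriction> ?S" by (rule graph_induce[OF S])
  let ?CC = "S.sccs_verts" and ?H = "\<lambda>C. (G \<restriction> ?S) \<restriction> C"
  define kk where "kk C = card C - sat_number (?H C)" for C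
  have H: "?H C \<in> S.sccs" if "C \<in> ?CC" for C by (rule S.in_verts_sccsD_sccs[OF that])
  have un: "\<Union> ?CC = ?S"
    using S.sccs_verts_subsets S.scc_of_in_sccs_verts S.in_scc_of_self by fastforce
  have disj: "disjoint ?CC"
    using S.sccs_verts_disjoint by (auto simp: disjoint_def)
  have finC: "finite C" if "C \<in> ?CC" for C
    using S.sccs_verts_subsets[OF that] S.finite_verts finite_subset by blast
  \<comment> \<open>Ensures that the truncated subtraction in \<open>kk\<close> is a true
    one.\<close>
  have sat: "sat_number (?H C) \<le> card C" if C: "C \<in> ?CC" for C
  proof -
    interpret H: graph "?H C" by (rule S.scc_in_sccs(4)[OF H[OF C]])
    show ?thesis using H.sat_number_obtains[OF S.scc_in_sccs(3)[OF H[OF C]]] by auto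
  qed
  show ?thesis
  proof (rule colon_witness_exists[OF simple_edges_edges Union_edges finite_verts F cover disj un])
    show "2 \<le> card C" if C: "C \<in> ?CC" for C
    proof -
      interpret H: graph "?H C" by (rule S.scc_in_sccs(4)[OF H[OF C]])
      \<comment> \<open>An odd cycle has at least three vertices.\<close>
      obtain r and P :: "nat \<Rightarrow> 'a" where "inj_on P {..<2 * r + 1}" "P ` {..<2 * r + 1} \<subseteq> C" "r > 0"
        using H.has_odd_cycleE[OF odd[OF H[OF C]]] by (metis induce_subgraph_verts)
      then show ?thesis using card_inj_on_le[OF _ _ finC[OF C], of P "{..<2 * r + 1}"] by simp
    qed
    show "\<exists>C\<in>?CC. e \<subseteq> C" if e: "e \<in> edges G" "e \<subseteq> ?S" for e
    proof -
      obtain u v where uv: "e = {u, v}" using simple_edges_edges e(1) by (auto simp: simple_edges_def)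
      then obtain C where C: "C \<in> ?CC" "u \<in> C" using e un by blast
      have "{u, v} \<in> edges (G \<restriction> ?S)" using e uv edges_induce[OF S] by simp
      then have "v \<in> C" using S.scc_closed_edge[OF H[OF C(1)], of u v] C(2) by simp
      then show ?thesis using C uv by blast
    qed
    show "\<exists>f. critical (edges G) f K C" if C: "C \<in> ?CC" and K: "kk C \<le> K" for C K
    proof -
      interpret H: graph "?H C" by (rule S.scc_in_sccs(4)[OF H[OF C]])
      have "\<exists>f. critical (edges (?H C)) f K (verts (?H C))"
        by (rule H.critical_component[OF S.scc_in_sccs(2)[OF H[OF C]] odd[OF H[OF C]]])
          (use K in \<open>simp add: kk_def\<close>)
      moreover have "edges (?H C) \<subseteq> edges G"
        using S.scc_in_sccs(5)[OF H[OF C]] edges_induce[OF S] by auto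
      ultimately show ?thesis using critical_mono by (metis induce_subgraph_verts)
    qed
    have "int (\<Sum>C\<in>?CC. kk C) = (\<Sum>C\<in>?CC. int (card C)) - (\<Sum>C\<in>?CC. int (sat_number (?H C)))"
      using sat by (simp add: kk_def of_nat_diff sum_subtractf)
    also have "(\<Sum>C\<in>?CC. int (card C)) = int (card ?S)"
      using card_Union_disjoint[of ?CC] disj finC un
      by (simp add: pairwise_def disjoint_def disjnt_def)
    also have "(\<Sum>C\<in>?CC. int (sat_number (?H C))) = (\<Sum>H\<in>S.sccs. int (sat_number H))"
      unfolding S.sccs_conv_sccs_verts
      by (subst sum.reindex) (auto intro: inj_on_inverseI[where g = verts])
    finally show "(\<Sum>C\<in>?CC. kk C) < t"
      using t unfolding s_subset_def by linarith
  qed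
qed

lemma sccs_empty: "pre_digraph.sccs (G \<restriction> {}) = {}"
proof -
  have "verts H = {}" if "induced_subgraph H (G \<restriction> {})" for H
    using that by (metis induce_subgraph_verts induced_imp_subgraph subgraph_imp_subverts subset_empty)
  then show ?thesis by (auto simp: pre_digraph.sccs_def strongly_connected_def)
qed

text \<open>In a bipartite graph no component can have an odd cycle, so \<open>U\<close> is empty
  and its value is 1, the one prescribed for bipartite graphs.\<close>

lemma s_subset_le_s_graph:
  assumes U: "U \<subseteq> verts G" and odd: "\<And>H. H \<in> pre_digraph.sccs (G \<restriction> U) \<Longrightarrow> has_odd_cycle H"
  shows "s_subset G U \<le> s_graph G"
proof (cases "bipartite G")
  case False
  let ?A = "{s_subset G U | U. U \<subseteq> verts G \<and> (\<forall>H \<in> pre_digraph.sccs (G \<restriction> U). has_odd_cycle H)}"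
  have "finite ?A"
    by (rule finite_subset[of _ "s_subset G ` Pow (verts G)"]) auto
  then have "s_subset G U \<le> Max ?A" using U odd by (intro Max_ge) auto
  then show ?thesis using False by (simp add: s_graph_def)
next
  case True
  interpret U: graph "G \<restriction> U" by (rule graph_induce[OF U])
  have "U = {}"
  proof (rule ccontr)
    assume "U \<noteq> {}"
    then obtain H where H: "H \<in> U.sccs" using U.exists_scc by auto
    interpret H: graph H by (rule U.scc_in_sccs(4)[OF H])
    obtain j n where "(j, j) \<in> adj (edges H) ^^ (2 * n + 1)"
      using H.has_odd_cycle_odd_closed_walk[OF odd[OF H]] by blast
    moreover have "adj (edges H) \<subseteq> adj (edges G)"
      using U.scc_in_sccs(5)[OF H] edges_induce[OF U] by (auto simp: adj_def)
    ultimately have "(j, j) \<in> adj (edges G) ^^ (2 * n + 1)"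
      by (rule subsetD[OF relpow_mono, rotated])
    from bipartite_no_odd_closed_walk[OF True this] show False by simp
  qed
  then show ?thesis using True by (simp add: s_graph_def s_subset_def sccs_empty)
qed

text \<open>The empty set of vertices contributes the value 1.\<close>

lemma s_graph_pos: "1 \<le> s_graph G"
  using s_subset_le_s_graph[of "{}"] by (simp add: sccs_empty s_subset_def)

end

text \<open>The right-hand side no longer depends on \<open>t\<close>. The bound on \<open>t\<close>
  enters in the construction of a witness, through the value of \<open>s_subset\<close> at the
  stable part.\<close>

lemma Ass_edge_ideal_power_stable:
  fixes G :: "('a::linorder, 'b) pre_digraph"
  assumes "graph G" and t: "s_graph G \<le> int t"
  defines "R \<equiv> mpoly_ring (verts G) :: (('a \<Rightarrow>\<^sub>0 nat) \<Rightarrow>\<^sub>0 'k::field) ring"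
  shows "Ass R (edge_ideal G [^]\<^bsub>ideals_set R\<^esub> t) = {prime_of (verts G) F | F. F \<subseteq> verts G \<and>
    (\<forall>e\<in>edges G. e \<inter> F \<noteq> {}) \<and>
    (\<forall>H \<in> pre_digraph.sccs (G \<restriction> stable_part (edges G) F). has_odd_cycle H)}"
proof -
  interpret graph G by fact
  have iff: "(\<exists>m. (\<forall>x. x \<notin> verts G \<longrightarrow> m x = 0) \<and> colon_witness (edges G) (verts G) F t m) \<longleftrightarrow>
    (\<forall>e\<in>edges G. e \<inter> F \<noteq> {}) \<and>
    (\<forall>H \<in> pre_digraph.sccs (G \<restriction> stable_part (edges G) F). has_odd_cycle H)"
    (is "?L \<longleftrightarrow> ?R") if F: "F \<subseteq> verts G" for F
  proof
    assume ?L
    then show ?R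
      using colon_witness_cover[OF _ Union_edges] odd_cycles_of_colon_witness[OF F] by blast
  next
    assume R: ?R
    have "stable_part (edges G) F \<subseteq> verts G" using F by (auto simp: stable_part_def)
    then have "s_subset G (stable_part (edges G) F) \<le> s_graph G"
      using R by (intro s_subset_le_s_graph) auto
    then show ?L
      using R t by (intro colon_witness_of_odd_cycles[OF F]) auto
  qed
  show ?thesis
    unfolding R_def Ass_edge_ideal_power[OF simple_edges_edges Union_edges finite_verts]
    by (intro Collect_cong ex_cong1 conj_cong refl, rule iff)
qed

theorem corollary3p7:
  fixes n :: nat and \<Gamma> :: "(nat, 'b) pre_digraph"
  assumes "n \<ge> 1" and "graph \<Gamma>" and "verts \<Gamma> = {1..n}"
  shows "int (astab (mpoly_ring {1..n}) (edge_ideal \<Gamma> :: ((nat \<Rightarrow>\<^sub>0 nat) \<Rightarrow>\<^sub>0 'k::field) set))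
    \<le> s_graph \<Gamma>"
proof -
  let ?R = "mpoly_ring {1..n} :: ((nat \<Rightarrow>\<^sub>0 nat) \<Rightarrow>\<^sub>0 'k) ring"
  have pos: "1 \<le> s_graph \<Gamma>" by (rule graph.s_graph_pos[OF assms(2)])
  have "Ass ?R (edge_ideal \<Gamma> [^]\<^bsub>ideals_set ?R\<^esub> t) = Ass ?R (edge_ideal \<Gamma> [^]\<^bsub>ideals_set ?R\<^esub> (t + 1))"
    if "nat (s_graph \<Gamma>) \<le> t" for t
  proof -
    have "s_graph \<Gamma> \<le> int t" "s_graph \<Gamma> \<le> int (t + 1)" using that pos by linarith+
    note this[THEN Ass_edge_ideal_power_stable[OF assms(2), where 'k = 'k], unfolded assms(3)]
    then show ?thesis by (rule trans[OF _ sym])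
  qed
  \<comment> \<open>\<open>astab\<close> is a least number, so it suffices that the bound itself has
    the defining property; positivity gives the clause \<open>t0 >= 1\<close>.\<close>
  then have "astab ?R (edge_ideal \<Gamma>) \<le> nat (s_graph \<Gamma>)"
    unfolding astab_def using pos by (intro Least_le) simp
  then show ?thesis using pos by linarith
qed

end
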